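(* Let $k\ge 0$ and suppose that - the input-affine system has a single input, i.e. it is $\dot x(t)=f(x(t))+g(x(t))\,v(t)$, - $f$ and $g$ are $C^2$ functions, and - $w$ is a real-valued (measurable) function on $[t_k,t_{k+1}]$ with $|w(t)|\le rV_1$ for some constant $r\in\mathbb{R}$, satisfying $$\int_{t_k}^{t_{k+1}}\bigl(v(t)-w(t)\bigr)\,dt=0,\qquad \int_{t_k}^{t_{k+1}}(t-t_{k+1/2})\bigl(v(t)-w(t)\bigr)\,dt=0.$$ Let $x$ and $y$ be solutions on $[t_k,t_{k+1}]$ of $\dot x=f(x)+g(x)v(t)$ and of $\dot y=f(y)+g(y)w(t)$ respectively, with $x(t_k)=y(t_k)$. Then the local error $\|x(t_{k+1})-y(t_{k+1})\|$ is $O(h^3)$, and $$\begin{aligned} &\bigl(1-L(h_k/2)-h_k\,r\,L'\bigr)\,\|x(t_{k+1})-y(t_{k+1})\|\le\\ &\quad\frac{h_k^3}{4}(1+r)\,K'\Bigl((2rH'+H)(K+rK')+L^2+(3rL+2r^2L')L'\Bigr)\varphi(\Lambda h_k)\\ &\quad+\frac{h_k^3}{24}(K+K')\Bigl((1+r)\bigl(3(HK'+LL')+4(H'K+LL')\bigr)+8(1+r^2)\bigl(H'K'+(L')^2\bigr)\Bigr). \end{aligned}$$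
   Context: Setting. $f,g:\mathbb{R}^n\to\mathbb{R}^n$; $v$ is an arbitrary measurable real-valued function with $v(t)\in[-V_1,V_1]$, $V_1>0$. Solutions are absolutely continuous functions satisfying the equation for almost every $t$. The interval $[0,T]$ is partitioned as $0=t_0<t_1<\dots<t_N=T$, $h_k=t_{k+1}-t_k$ and $t_{k+1/2}=t_k+h_k/2$. Norms. $\|\cdot\|$ is the supremum norm on $\mathbb{R}^n$ and the induced norms on matrices and on bilinear maps (for second derivatives $D^2$). The logarithmic norm of a square matrix $Q$ is $\lambda(Q)=\lim_{h\to0^+}(\|I+hQ\|-1)/h$, i.e. $\lambda(Q)=\max_k\{q_{kk}+\sum_{i\ne k}|q_{ki}|\}$. Bounds. $B\subset\mathbb{R}^n$ is a box containing the values on $[0,T]$ of all solutions under consideration of both systems (for all admissible inputs, including zero inputs). The constants satisfy, for all $z\in B$: $\|f(z)\|\le K$, $\|g(z)\|\le K_1$, $\lambda(Df(z))\le\Lambda$, $\|Df(z)\|\le L$, $\|Dg(z)\|\le L_1$, $\|D^2f(z)\|\le H$, $\|D^2g(z)\|\le H_1$. Put $K'=V_1K_1$, $L'=V_1L_1$, $H'=V_1H_1$, and $\varphi(s)=(e^s-1)/s$, with $\varphi(0)=1$. "Local error is $O(h^3)$" means bounded by $C h_k^3$ for all sufficiently small $h_k$, with $C$ depending only on $T$ and the constants above, not on $k$ or on the particular inputs. *)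

theory Defs
  imports "HOL-Analysis.Analysis"
begin

text \<open>
  The supremum norm on \<open>real ^ 'n\<close> is \<^const>\<open>infnorm\<close>; \<^const>\<open>norm\<close> and \<^const>\<open>onorm\<close> are Euclidean.
  The induced norms follow the pattern of \<^const>\<open>onorm\<close>, the quotient at \<open>0\<close> being \<open>0\<close>.
\<close>

definition matrix_infnorm :: "real ^ 'n ^ 'n \<Rightarrow> real" where
  "matrix_infnorm Q = (SUP u. infnorm (Q *v u) / infnorm u)"

definition bilinear_infnorm :: "(real ^ 'n \<Rightarrow> real ^ 'n \<Rightarrow> real ^ 'n) \<Rightarrow> real" where
  "bilinear_infnorm b = (SUP (u1, u2). infnorm (b u1 u2) / (infnorm u1 * infnorm u2))"

definition log_infnorm :: "real ^ 'n ^ 'n \<Rightarrow> real" where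
  "log_infnorm Q = Lim (at_right 0) (\<lambda>h. (matrix_infnorm (mat 1 + h *\<^sub>R Q) - 1) / h)"

definition C2 :: "('a::real_normed_vector \<Rightarrow> 'b::real_normed_vector) \<Rightarrow> bool" where
  "C2 f \<longleftrightarrow> (\<exists>(f' :: 'a \<Rightarrow> 'a \<Rightarrow>\<^sub>L 'b) (f'' :: 'a \<Rightarrow> 'a \<Rightarrow>\<^sub>L 'a \<Rightarrow>\<^sub>L 'b).
     (\<forall>z. (f has_derivative blinfun_apply (f' z)) (at z)) \<and>
     (\<forall>z. (f' has_derivative blinfun_apply (f'' z)) (at z)) \<and>
     continuous_on UNIV f'')"

definition second_derivative ::
    "('a::real_normed_vector \<Rightarrow> 'b::real_normed_vector) \<Rightarrow> 'a \<Rightarrow> 'a \<Rightarrow> 'a \<Rightarrow> 'b" where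
  "second_derivative f z u1 u2 =
     frechet_derivative (\<lambda>z'. frechet_derivative f (at z') u1) (at z) u2"

definition absolutely_continuous_fun :: "real \<Rightarrow> real \<Rightarrow> (real \<Rightarrow> 'a::metric_space) \<Rightarrow> bool" where
  "absolutely_continuous_fun a b x \<longleftrightarrow>
     (\<forall>\<epsilon>>0. \<exists>\<delta>>0. \<forall>(m::nat) c d.
        (\<forall>i<m. a \<le> c i \<and> c i \<le> d i \<and> d i \<le> b) \<and>
        disjoint_family_on (\<lambda>i. {c i<..<d i}) {..<m} \<and>
        (\<Sum>i<m. d i - c i) < \<delta>
        \<longrightarrow> (\<Sum>i<m. dist (x (c i)) (x (d i))) < \<epsilon>)"

definition input :: "real \<Rightarrow> real \<Rightarrow> real \<Rightarrow> (real \<Rightarrow> real) \<Rightarrow> bool" where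
  "input V a b v \<longleftrightarrow>
     v \<in> borel_measurable (lebesgue_on {a..b}) \<and> (\<forall>s\<in>{a..b}. \<bar>v s\<bar> \<le> V)"

definition solution ::
    "(real ^ 'n \<Rightarrow> real ^ 'n) \<Rightarrow> (real ^ 'n \<Rightarrow> real ^ 'n) \<Rightarrow> (real \<Rightarrow> real) \<Rightarrow>
     real \<Rightarrow> real \<Rightarrow> (real \<Rightarrow> real ^ 'n) \<Rightarrow> bool" where
  "solution f g v a b x \<longleftrightarrow>
     absolutely_continuous_fun a b x \<and>
     (AE s in lebesgue_on {a..b}.
        (x has_vector_derivative f (x s) + v s *\<^sub>R g (x s)) (at s within {a..b}))"

definition time_partition :: "real \<Rightarrow> nat \<Rightarrow> (nat \<Rightarrow> real) \<Rightarrow> bool" where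
  "time_partition T N t \<longleftrightarrow> t 0 = 0 \<and> t N = T \<and> (\<forall>i<N. t i < t (Suc i))"

definition phi :: "real \<Rightarrow> real" where
  "phi s = (if s = 0 then 1 else (exp s - 1) / s)"

lemma infnorm_le_iff:
  fixes x :: "real ^ 'n"
  shows "infnorm x \<le> c \<longleftrightarrow> (\<forall>i. \<bar>x $ i\<bar> \<le> c)"
proof -
  have "infnorm x = (SUP i. \<bar>x $ i\<bar>)"
    unfolding infnorm_cart by (simp add: full_SetCompr_eq)
  then show ?thesis
    by (simp add: cSup_eq_Max)
qed

lemma matrix_infnorm_eq_Max:
  fixes Q :: "real ^ 'n ^ 'n"
  shows "matrix_infnorm Q = (MAX k. \<Sum>i\<in>UNIV. \<bar>Q $ k $ i\<bar>)" (is "_ = ?M")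
proof -
  let ?R = "\<lambda>k. \<Sum>i\<in>UNIV. \<bar>Q $ k $ i\<bar>"
  have R: "?R k \<le> ?M" for k
    by (rule Max_ge) auto
  have M0: "0 \<le> ?M"
    using R[of undefined] by (meson order_trans sum_nonneg abs_ge_zero)
  have upper: "infnorm (Q *v u) \<le> ?M * infnorm u" for u
    unfolding infnorm_le_iff
  proof
    fix k
    have "\<bar>(Q *v u) $ k\<bar> \<le> (\<Sum>i\<in>UNIV. \<bar>Q $ k $ i * u $ i\<bar>)"
      unfolding matrix_vector_mult_def by (simp add: sum_abs)
    also have "\<dots> \<le> (\<Sum>i\<in>UNIV. \<bar>Q $ k $ i\<bar> * infnorm u)"
      by (intro sum_mono) (simp add: abs_mult mult_left_mono component_le_infnorm_cart)
    also have "\<dots> = ?R k * infnorm u"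
      by (simp add: sum_distrib_right)
    also have "\<dots> \<le> ?M * infnorm u"
      by (intro mult_right_mono R infnorm_pos_le)
    finally show "\<bar>(Q *v u) $ k\<bar> \<le> ?M * infnorm u" .
  qed
  have upper': "infnorm (Q *v u) / infnorm u \<le> ?M" for u
    using upper[of u] M0 infnorm_pos_le[of u]
    by (cases "infnorm u = 0") (auto simp: divide_simps)
  have lower: "?R k \<le> matrix_infnorm Q" for k
  proof -
    let ?u = "(\<chi> i. if Q $ k $ i < 0 then -1 else 1) :: real ^ 'n"
    have "infnorm ?u = 1"
      using component_le_infnorm_cart[of ?u k]
      by (intro antisym) (auto simp: infnorm_le_iff split: if_splits)
    moreover have "(Q *v ?u) $ k = ?R k"
      unfolding matrix_vector_mult_def by (auto intro!: sum.cong)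
    ultimately have "?R k \<le> infnorm (Q *v ?u) / infnorm ?u"
      using component_le_infnorm_cart[of "Q *v ?u" k] by simp
    also have "\<dots> \<le> matrix_infnorm Q"
      unfolding matrix_infnorm_def
      by (intro cSUP_upper bdd_aboveI2[where M = ?M] upper') auto
    finally show ?thesis .
  qed
  show ?thesis
  proof (rule antisym)
    show "matrix_infnorm Q \<le> ?M"
      unfolding matrix_infnorm_def by (intro cSUP_least upper') auto
    show "?M \<le> matrix_infnorm Q"
      by (auto intro!: Max.boundedI lower)
  qed
qed

lemma log_infnorm_eq_Max:
  fixes Q :: "real ^ 'n ^ 'n"
  shows "log_infnorm Q = (MAX k. Q $ k $ k + (\<Sum>i\<in>UNIV - {k}. \<bar>Q $ k $ i\<bar>))" (is "_ = ?M")
proof -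
  let ?m = "\<lambda>k. Q $ k $ k + (\<Sum>i\<in>UNIV - {k}. \<bar>Q $ k $ i\<bar>)"
  define e where "e = 1 / (1 + (\<Sum>k\<in>UNIV. \<bar>Q $ k $ k\<bar>))"
  have pos: "0 < 1 + (\<Sum>k\<in>UNIV. \<bar>Q $ k $ k\<bar>)"
    by (intro add_pos_nonneg sum_nonneg) auto
  then have e: "0 < e" by (simp add: e_def)
  have eq: "(matrix_infnorm (mat 1 + h *\<^sub>R Q) - 1) / h = ?M" if h: "0 < h" "h < e" for h
  proof -
    have row: "(\<Sum>i\<in>UNIV. \<bar>(mat 1 + h *\<^sub>R Q) $ k $ i\<bar>) = 1 + h * ?m k" for k
    proof -
      have "\<bar>Q $ k $ k\<bar> \<le> (\<Sum>k\<in>UNIV. \<bar>Q $ k $ k\<bar>)"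
        by (rule member_le_sum) auto
      then have "h * \<bar>Q $ k $ k\<bar> \<le> e * (1 + (\<Sum>k\<in>UNIV. \<bar>Q $ k $ k\<bar>))"
        using h by (intro mult_mono) auto
      also have "\<dots> = 1" using pos by (simp add: e_def)
      finally have "\<bar>h * Q $ k $ k\<bar> \<le> 1" using h by (simp add: abs_mult)
      then have "\<bar>1 + h * Q $ k $ k\<bar> = 1 + h * Q $ k $ k" by linarith
      moreover have "(\<Sum>i\<in>UNIV - {k}. \<bar>(mat 1 + h *\<^sub>R Q) $ k $ i\<bar>)
          = h * (\<Sum>i\<in>UNIV - {k}. \<bar>Q $ k $ i\<bar>)"
        unfolding sum_distrib_left using h
        by (intro sum.cong) (auto simp: mat_def abs_mult)
      ultimately show ?thesis
        by (subst sum.remove[of _ k]) (auto simp: mat_def algebra_simps)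
    qed
    have "mono (\<lambda>s. 1 + h * s)" using h by (auto intro!: monoI)
    then have "(MAX k. 1 + h * ?m k) = 1 + h * ?M"
      by (subst mono_Max_commute) (auto simp: image_image)
    then show ?thesis
      unfolding matrix_infnorm_eq_Max row using h by simp
  qed
  have "\<forall>\<^sub>F h in at_right 0. (matrix_infnorm (mat 1 + h *\<^sub>R Q) - 1) / h = ?M"
    unfolding eventually_at_right_field using e eq by auto
  then have "((\<lambda>h. (matrix_infnorm (mat 1 + h *\<^sub>R Q) - 1) / h) \<longlongrightarrow> ?M) (at_right 0)"
    by (rule tendsto_eventually)
  then show ?thesis
    unfolding log_infnorm_def by (intro tendsto_Lim) auto
qed

end

theory Submission
  imports Defs
begin

text \<open>
  Put \<open>z = x - y\<close> and \<open>u = v - w\<close>, so that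
  \<open>z' = (f(x) - f(y)) + u g(x) + w (g(x) - g(y))\<close>. A crude estimate gives only \<open>z = O(h)\<close>, and
  this is all that holds inside the step; the two extra powers of \<open>h\<close> at the right end come from
  integrating by parts against weights that vanish at both ends of the step.

  With \<open>p\<close>, \<open>q\<close> the integrals of \<open>v\<close>, \<open>w\<close> from the left end, \<open>U = p - q\<close>, and \<open>m\<close> the midpoint,
  subtract from \<open>z\<close> the terms \<open>(t - m) (f(x) - f(y))\<close>, \<open>U g(x)\<close> and \<open>q (g(x) - g(y))\<close>. What
  remains has a derivative of size \<open>h\<^sup>2\<close> except for the parts \<open>- (t - m) u Df(x) g(x)\<close>,
  \<open>- U Dg(x) f(x)\<close> and \<open>- (U v + q u) Dg(x) g(x)\<close>, which are only \<open>O(h)\<close>. The scalar factors of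
  the first two have vanishing integrals by the two moment conditions. Since there is a
  single input, the factor of the third is an exact derivative: \<open>U v + q u = p v - q w\<close> is the
  derivative of \<open>R = (p\<^sup>2 - q\<^sup>2) / 2\<close>, and \<open>R\<close> vanishes at both ends because \<open>p\<close> and \<open>q\<close> agree
  there. One more integration by parts, with \<open>P\<close>, \<open>W\<close> and \<open>R\<close> the primitives of the three factors,
  therefore removes these parts. The result is a function \<open>M\<close> with \<open>M = 0\<close> at the left end, with
  \<open>M = z - (h/2) (f(x) - f(y)) - q (g(x) - g(y))\<close> at the right end, and with a derivative
  consisting of differences of first-order expressions at \<open>x\<close> and \<open>y\<close> times \<open>O(h)\<close>, and of
  \<open>P\<close>, \<open>W\<close>, \<open>R\<close> times bounded terms. The two corrections at the right end produce the factor
  \<open>1 - L h/2 - h r L'\<close> (\<open>local_error\<close>).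

  The differences at \<open>x\<close> and \<open>y\<close> are multiples of the distance \<open>|z|\<close>, which is at most
  \<open>(1 + r) K' h \<phi>(\<Lambda> h)\<close> by the logarithmic norm (\<open>infnorm_growth_le\<close>,
  \<open>trajectories_diff_le\<close>).

  The inputs are merely measurable, so the calculus is done with indefinite integrals of bounded
  measurable functions (\<open>primitive_on\<close>). Solutions enter this class through the fundamental
  theorem for absolutely continuous functions (\<open>absolutely_continuous_has_integral\<close>); the class
  is closed under products (\<open>primitive_on_scaleR\<close>), and composing a solution with a
  differentiable map stays inside it (\<open>primitive_on_along_solution\<close>).
\<close>

section \<open>Absolutely continuous functions\<close>

text \<open>
  The definition speaks of families indexed by an initial segment of the naturals; the cells of a
  tagged division are indexed by the division itself.
\<close>

lemma absolutely_continuous_finite_family: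
  assumes "absolutely_continuous_fun a b F" and "0 < e"
  obtains \<eta> where "0 < \<eta>"
    and "\<And>I c d. \<lbrakk>finite I; \<And>i. i \<in> I \<Longrightarrow> a \<le> c i \<and> c i \<le> d i \<and> d i \<le> b;
                 disjoint_family_on (\<lambda>i. {c i<..<d i}) I; (\<Sum>i\<in>I. d i - c i) < \<eta>\<rbrakk>
           \<Longrightarrow> (\<Sum>i\<in>I. dist (F (c i)) (F (d i))) < e"
proof -
  obtain \<eta> where \<eta>: "0 < \<eta>"
    and AC: "\<And>m c d. \<lbrakk>\<forall>i<(m::nat). a \<le> c i \<and> c i \<le> d i \<and> d i \<le> b;
                 disjoint_family_on (\<lambda>i. {c i<..<d i}) {..<m}; (\<Sum>i<m. d i - c i) < \<eta>\<rbrakk>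
           \<Longrightarrow> (\<Sum>i<m. dist (F (c i)) (F (d i))) < e"
    using assms unfolding absolutely_continuous_fun_def by (elim allE[of _ e]) blast
  have "(\<Sum>i\<in>I. dist (F (c i)) (F (d i))) < e"
    if I: "finite I" "\<And>i. i \<in> I \<Longrightarrow> a \<le> c i \<and> c i \<le> d i \<and> d i \<le> b"
      and disj: "disjoint_family_on (\<lambda>i. {c i<..<d i}) I" and len: "(\<Sum>i\<in>I. d i - c i) < \<eta>"
    for I :: "'b set" and c d
  proof -
    obtain j where j: "bij_betw j {..<card I} I"
      using ex_bij_betw_nat_finite[OF I(1)] by (auto simp: atLeast0LessThan)
    have reindex: "(\<Sum>i<card I. u (j i)) = (\<Sum>i\<in>I. u i)" for u :: "'b \<Rightarrow> real"
      by (rule sum.reindex_bij_betw[OF j])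
    have jI: "j i \<in> I" if "i < card I" for i
      using bij_betwE[OF j] that by auto
    have "disjoint_family_on (\<lambda>i. {c (j i)<..<d (j i)}) {..<card I}"
      using disj bij_betw_imp_inj_on[OF j] jI
      unfolding disjoint_family_on_def inj_on_def by blast
    then have "(\<Sum>i<card I. dist (F (c (j i))) (F (d (j i)))) < e"
      using I(2) jI len reindex[of "\<lambda>i. d i - c i"] by (intro AC) auto
    then show ?thesis
      using reindex[of "\<lambda>i. dist (F (c i)) (F (d i))"] by simp
  qed
  with \<eta> show ?thesis by (rule that)
qed

lemma Lipschitz_imp_absolutely_continuous:
  fixes F :: "real \<Rightarrow> 'a::metric_space"
  assumes lip: "\<And>s t. \<lbrakk>a \<le> s; s \<le> t; t \<le> b\<rbrakk> \<Longrightarrow> dist (F s) (F t) \<le> C * (t - s)"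
  shows "absolutely_continuous_fun a b F"
  unfolding absolutely_continuous_fun_def
proof (intro allI impI)
  fix e :: real assume e: "0 < e"
  define M where "M = \<bar>C\<bar> + 1"
  have M: "0 < M" "C \<le> M" by (auto simp: M_def)
  show "\<exists>\<delta>>0. \<forall>(m::nat) c d.
        (\<forall>i<m. a \<le> c i \<and> c i \<le> d i \<and> d i \<le> b) \<and>
        disjoint_family_on (\<lambda>i. {c i<..<d i}) {..<m} \<and> (\<Sum>i<m. d i - c i) < \<delta>
        \<longrightarrow> (\<Sum>i<m. dist (F (c i)) (F (d i))) < e"
  proof (intro exI[of _ "e / M"] conjI allI impI)
    show "0 < e / M" using e M by simp
    fix m :: nat and c d
    assume *: "(\<forall>i<m. a \<le> c i \<and> c i \<le> d i \<and> d i \<le> b) \<and>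
        disjoint_family_on (\<lambda>i. {c i<..<d i}) {..<m} \<and> (\<Sum>i<m. d i - c i) < e / M"
    have "dist (F (c i)) (F (d i)) \<le> M * (d i - c i)" if "i < m" for i
      using lip[of "c i" "d i"] * that M(2) mult_right_mono[OF M(2), of "d i - c i"] by fastforce
    then have "(\<Sum>i<m. dist (F (c i)) (F (d i))) \<le> (\<Sum>i<m. M * (d i - c i))"
      by (intro sum_mono) auto
    also have "\<dots> = M * (\<Sum>i<m. d i - c i)" by (simp add: sum_distrib_left)
    also have "\<dots> < M * (e / M)" using * M by (intro mult_strict_left_mono) auto
    also have "\<dots> = e" using M by simp
    finally show "(\<Sum>i<m. dist (F (c i)) (F (d i))) < e" .
  qed
qed

lemma absolutely_continuous_imp_continuous_on:
  fixes F :: "real \<Rightarrow> 'a::metric_space"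
  assumes "absolutely_continuous_fun a b F"
  shows "continuous_on {a..b} F"
  unfolding continuous_on_iff
proof (intro ballI allI impI)
  fix s e :: real assume s: "s \<in> {a..b}" and e: "0 < e"
  obtain \<eta> where \<eta>: "0 < \<eta>"
    and small: "\<And>I c d. \<lbrakk>finite (I :: nat set); \<And>i. i \<in> I \<Longrightarrow> a \<le> c i \<and> c i \<le> d i \<and> d i \<le> b;
                 disjoint_family_on (\<lambda>i. {c i<..<d i}) I; (\<Sum>i\<in>I. d i - c i) < \<eta>\<rbrakk>
           \<Longrightarrow> (\<Sum>i\<in>I. dist (F (c i)) (F (d i))) < e"
    by (rule absolutely_continuous_finite_family[OF assms e, where ?'b = nat]) blast
  have "dist (F t) (F s) < e" if t: "t \<in> {a..b}" "dist t s < \<eta>" for t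
  proof -
    have "(\<Sum>i\<in>{0::nat}. dist (F (min s t)) (F (max s t))) < e"
      using s t by (intro small) (auto simp: disjoint_family_on_def dist_real_def)
    then show ?thesis
      by (cases "s \<le> t") (auto simp: min_def max_def dist_commute)
  qed
  with \<eta> show "\<exists>d>0. \<forall>t\<in>{a..b}. dist t s < d \<longrightarrow> dist (F t) (F s) < e"
    by blast
qed

text \<open>
  The fundamental theorem of calculus for absolutely continuous functions, with the gauge
  integral. At a tag outside the null set the gauge enforces differentiability up to a multiple
  of the cell length. A tag inside the null set keeps its cell within an open set of small measure,
  so that absolute continuity bounds the total increment over these cells.
\<close>

lemma absolutely_continuous_has_integral:
  fixes F :: "real \<Rightarrow> 'a::euclidean_space"
  assumes "a \<le> b" and AC: "absolutely_continuous_fun a b F" and N: "negligible N"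
    and deriv: "\<And>s. s \<in> {a..b} - N \<Longrightarrow> (F has_vector_derivative \<phi> s) (at s within {a..b})"
  shows "(\<phi> has_integral (F b - F a)) {a..b}"
proof -
  define \<psi> where "\<psi> s = (if s \<in> N then 0 else \<phi> s)" for s
  have "(\<psi> has_integral (F b - F a)) {a..b}"
    unfolding has_integral_real
  proof (intro allI impI)
    fix e :: real assume e: "0 < e"
    define e' where "e' = e / (2 * (b - a + 1))"
    have e': "0 < e'" "e' * (b - a) \<le> e / 2"
      using e \<open>a \<le> b\<close> by (auto simp: e'_def field_simps)
    obtain \<eta> where \<eta>: "0 < \<eta>"
      and small: "\<And>I c d. \<lbrakk>finite (I :: (real \<times> real set) set);
            \<And>i. i \<in> I \<Longrightarrow> a \<le> c i \<and> c i \<le> d i \<and> d i \<le> b;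
            disjoint_family_on (\<lambda>i. {c i<..<d i}) I; (\<Sum>i\<in>I. d i - c i) < \<eta>\<rbrakk>
           \<Longrightarrow> (\<Sum>i\<in>I. dist (F (c i)) (F (d i))) < e / 2"
      by (rule absolutely_continuous_finite_family[OF AC half_gt_zero[OF e],
            where ?'b = "real \<times> real set"]) blast
    have N0: "N \<in> null_sets lebesgue"
      using N by (simp add: negligible_iff_null_sets)
    obtain G where G: "open G" "N \<subseteq> G" "emeasure lebesgue (G - N) < ennreal \<eta>"
      using sets_lebesgue_outer_open[OF null_setsD2[OF N0] \<eta>] by metis
    have G_small: "emeasure lebesgue G < ennreal \<eta>"
      using G(3) emeasure_Diff_null_set[OF N0, of G] G(1) by (metis lborelD sets_completionI_sets open_Collect_neg borel_open sets_lborel)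
    have "\<exists>\<rho>>0. s \<in> N \<longrightarrow> ball s \<rho> \<subseteq> G" for s
    proof (cases "s \<in> N")
      case True
      then show ?thesis using G openE by blast
    next
      case False
      then show ?thesis by (intro exI[of _ 1]) auto
    qed
    then obtain \<rho> where \<rho>: "\<And>s. 0 < \<rho> s" "\<And>s. s \<in> N \<Longrightarrow> ball s (\<rho> s) \<subseteq> G"
      by metis
    have "\<exists>d>0. s \<in> {a..b} - N \<longrightarrow>
         (\<forall>t\<in>{a..b}. norm (t - s) < d \<longrightarrow> norm (F t - F s - (t - s) *\<^sub>R \<phi> s) \<le> e' * norm (t - s))" for s
    proof (cases "s \<in> {a..b} - N")
      case True
      then show ?thesis
        using deriv[OF True] e'(1) unfolding has_vector_derivative_def has_derivative_within_alt
        by blast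
    next
      case False
      then show ?thesis by (intro exI[of _ 1]) auto
    qed
    then obtain d where d: "\<And>s. 0 < d s"
      "\<And>s t. \<lbrakk>s \<in> {a..b} - N; t \<in> {a..b}; norm (t - s) < d s\<rbrakk>
         \<Longrightarrow> norm (F t - F s - (t - s) *\<^sub>R \<phi> s) \<le> e' * norm (t - s)"
      by metis
    define \<gamma> where "\<gamma> s = ball s (if s \<in> N then \<rho> s else d s)" for s
    have gauge: "gauge \<gamma>"
      unfolding \<gamma>_def by (intro gauge_ball_dependent) (use \<rho> d in auto)
    have cells: "norm ((\<Sum>(s, J)\<in>p. measure lborel J *\<^sub>R \<psi> s) - (F b - F a)) < e"
      if p: "p tagged_division_of {a..b}" and fine: "\<gamma> fine p" for p
    proof -
      define q where "q = {(s, J) \<in> p. s \<in> N}"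
      have "finite p" using p by blast
      then have "finite q" by (rule rev_finite_subset) (auto simp: q_def)
      have J: "Inf J \<le> s" "s \<le> Sup J" "J = {Inf J..Sup J}" "a \<le> Inf J" "Sup J \<le> b"
        "J \<subseteq> \<gamma> s" "measure lborel J = Sup J - Inf J" "Inf J \<in> J" "Sup J \<in> J"
        "interior J = {Inf J<..<Sup J}"
        if "(s, J) \<in> p" for s J
      proof -
        from p that obtain u v where uv: "J = {u..v}" "s \<in> J" "J \<subseteq> {a..b}"
          by (metis tagged_division_ofD(2,3,4) box_real(2))
        then show "Inf J \<le> s" "s \<le> Sup J" "J = {Inf J..Sup J}" "a \<le> Inf J" "Sup J \<le> b"
          "measure lborel J = Sup J - Inf J" "Inf J \<in> J" "Sup J \<in> J" "interior J = {Inf J<..<Sup J}"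
          by auto
        show "J \<subseteq> \<gamma> s" using fine that by blast
      qed
      have split: "(\<Sum>i\<in>p. u i) = (\<Sum>i\<in>p - q. u i) + (\<Sum>i\<in>q. u i)" for u :: "_ \<Rightarrow> 'c::comm_monoid_add"
        using sum.subset_diff[of q p u] \<open>finite p\<close> by (auto simp: q_def)
      define \<Delta> where "\<Delta> = (\<lambda>(s, J). measure lborel J *\<^sub>R \<psi> s - (F (Sup J) - F (Inf J)))"
      have "(\<Sum>(s, J)\<in>p. measure lborel J *\<^sub>R \<psi> s) - (F b - F a) = sum \<Delta> p"
        using additive_tagged_division_1[OF \<open>a \<le> b\<close> p, of F]
        by (simp add: \<Delta>_def sum_subtractf split_def)
      also have "\<dots> = sum \<Delta> (p - q) + sum \<Delta> q" by (rule split)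
      finally have eq: "(\<Sum>(s, J)\<in>p. measure lborel J *\<^sub>R \<psi> s) - (F b - F a) = sum \<Delta> (p - q) + sum \<Delta> q" .
      have "norm (sum \<Delta> (p - q)) \<le> (\<Sum>(s, J)\<in>p - q. e' * (Sup J - Inf J))"
      proof (rule sum_norm_le, clarify)
        fix s J assume sJ: "(s, J) \<in> p" "(s, J) \<notin> q"
        then have s: "s \<notin> N" by (auto simp: q_def)
        note J = J[OF sJ(1)]
        have near: "norm (Inf J - s) < d s" "norm (Sup J - s) < d s"
          using J(6,8,9) s by (auto simp: \<gamma>_def dist_real_def)
        have "\<Delta> (s, J) = (F (Inf J) - F s - (Inf J - s) *\<^sub>R \<phi> s) - (F (Sup J) - F s - (Sup J - s) *\<^sub>R \<phi> s)"
          using s by (simp add: \<Delta>_def \<psi>_def J(7) algebra_simps)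
        also have "norm \<dots> \<le> e' * norm (Inf J - s) + e' * norm (Sup J - s)"
          using near s J(1,2,4,5) by (intro order_trans[OF norm_triangle_ineq4] add_mono d) auto
        also have "\<dots> = e' * (Sup J - Inf J)"
          using J(1,2) by (simp add: algebra_simps)
        finally show "norm (\<Delta> (s, J)) \<le> e' * (Sup J - Inf J)" .
      qed
      also have "\<dots> \<le> (\<Sum>(s, J)\<in>p. e' * (Sup J - Inf J))"
        using \<open>finite p\<close> e'(1) J(1,2) by (intro sum_mono2) force+
      also have "\<dots> = e' * (b - a)"
        using additive_tagged_division_1[OF \<open>a \<le> b\<close> p, of "\<lambda>s. s"]
        by (simp add: split_def flip: sum_distrib_left)
      finally have good: "norm (sum \<Delta> (p - q)) \<le> e / 2" using e'(2) by simp
      \<comment> \<open>The cells tagged in the exceptional set have small total length, as they lie in \<open>G\<close>.\<close>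
      let ?I = "\<lambda>i. {Inf (snd i)<..<Sup (snd i)}"
      have cell: "fst i \<in> N" "Inf (snd i) \<le> fst i" "fst i \<le> Sup (snd i)" "a \<le> Inf (snd i)"
        "Sup (snd i) \<le> b" "snd i \<subseteq> \<gamma> (fst i)" "interior (snd i) = ?I i" if "i \<in> q" for i
        using J[of "fst i" "snd i"] that by (auto simp: q_def)
      have disj: "disjoint_family_on ?I q"
        unfolding disjoint_family_on_def
      proof (intro ballI impI)
        fix i j assume *: "i \<in> q" "j \<in> q" "i \<noteq> j"
        then have "interior (snd i) \<inter> interior (snd j) = {}"
          using tagged_division_ofD(5)[OF p, of "fst i" "snd i" "fst j" "snd j"]
          unfolding q_def by (auto simp: prod_eq_iff)
        then show "?I i \<inter> ?I j = {}"
          using cell(7) * by simp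
      qed
      have "(\<Sum>i\<in>q. Sup (snd i) - Inf (snd i)) = (\<Sum>i\<in>q. measure lebesgue (?I i))"
        by (intro sum.cong refl) (simp add: order_trans[OF cell(2,3)])
      also have "\<dots> = measure lebesgue (\<Union>i\<in>q. ?I i)"
        using \<open>finite q\<close> disj by (intro measure_finite_Union[symmetric])
          (auto simp: order_trans[OF cell(2,3)])
      also have "\<dots> < \<eta>"
      proof -
        have "?I i \<subseteq> G" if "i \<in> q" for i
          using cell(1,6,7)[OF that] \<rho>(2)[of "fst i"] interior_subset[of "snd i"] by (auto simp: \<gamma>_def)
        then have "(\<Union>i\<in>q. ?I i) \<subseteq> G" by blast
        then have "emeasure lebesgue (\<Union>i\<in>q. ?I i) \<le> emeasure lebesgue G"
          by (rule emeasure_mono) (use G(1) in auto)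
        also note G_small
        finally have "emeasure lebesgue (\<Union>i\<in>q. ?I i) < ennreal \<eta>" .
        moreover from this have "emeasure lebesgue (\<Union>i\<in>q. ?I i) \<noteq> top" by auto
        ultimately show ?thesis
          by (metis emeasure_eq_ennreal_measure ennreal_less_iff measure_nonneg)
      qed
      finally have "(\<Sum>i\<in>q. Sup (snd i) - Inf (snd i)) < \<eta>" .
      then have "(\<Sum>i\<in>q. dist (F (Inf (snd i))) (F (Sup (snd i)))) < e / 2"
        using \<open>finite q\<close> cell disj by (intro small) (auto simp: order_trans[OF cell(2,3)])
      moreover have "norm (sum \<Delta> q) \<le> (\<Sum>i\<in>q. dist (F (Inf (snd i))) (F (Sup (snd i))))"
        by (rule sum_norm_le) (auto simp: \<Delta>_def q_def \<psi>_def dist_norm)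
      ultimately have "norm (sum \<Delta> q) < e / 2" by simp
      with good show ?thesis
        unfolding eq by (metis add_le_less_mono field_sum_of_halves norm_triangle_lt order_le_less_trans)
    qed
    show "\<exists>\<gamma>. gauge \<gamma> \<and> (\<forall>p. p tagged_division_of {a..b} \<and> \<gamma> fine p \<longrightarrow>
        norm ((\<Sum>(s, J)\<in>p. measure lborel J *\<^sub>R \<psi> s) - (F b - F a)) < e)"
      by (intro exI[of _ \<gamma>] conjI allI impI gauge cells) auto
  qed
  then show ?thesis
    by (rule has_integral_spike[OF N, rotated]) (simp add: \<psi>_def)
qed

section \<open>Primitives of bounded measurable functions\<close>

text \<open>
  Over \<open>n\<close> equal steps the quadratic errors add up to \<open>O(1/n)\<close>. This replaces arguments by
  differentiation at every point, which is not available for primitives of measurable functions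
  nor for a supremum norm.
\<close>

lemma le_of_quadratic_increments:
  fixes \<psi> :: "real \<Rightarrow> real"
  assumes "a \<le> b" "0 < \<delta>"
    and step: "\<And>s t. \<lbrakk>a \<le> s; s \<le> t; t \<le> b; t - s \<le> \<delta>\<rbrakk> \<Longrightarrow> \<psi> t \<le> \<psi> s + C * (t - s)\<^sup>2"
  shows "\<psi> b \<le> \<psi> a"
proof -
  have bound: "\<psi> b \<le> \<psi> a + C * (b - a)\<^sup>2 / real n" if n: "0 < n" "(b - a) / real n \<le> \<delta>" for n :: nat
  proof -
    define d where "d = (b - a) / real n"
    have d: "0 \<le> d" "d \<le> \<delta>" "real n * d = b - a"
      using n \<open>a \<le> b\<close> by (auto simp: d_def)
    have "\<psi> (a + real j * d) \<le> \<psi> a + real j * (C * d\<^sup>2)" if "j \<le> n" for j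
      using that
    proof (induction j)
      case (Suc j)
      have "real (Suc j) * d \<le> real n * d"
        using Suc.prems d(1) by (intro mult_right_mono) auto
      then have "\<psi> (a + real (Suc j) * d) \<le> \<psi> (a + real j * d) + C * (a + real (Suc j) * d - (a + real j * d))\<^sup>2"
        using d by (intro step) (auto simp: algebra_simps)
      with Suc show ?case by (simp add: algebra_simps)
    qed simp
    from this[of n] have "\<psi> b \<le> \<psi> a + real n * (C * d\<^sup>2)"
      using d(3) by simp
    also have "real n * (C * d\<^sup>2) = C * (b - a)\<^sup>2 / real n"
      using n by (simp add: d_def power2_eq_square)
    finally show ?thesis .
  qed
  have lim: "(\<lambda>n. \<psi> a + C * (b - a)\<^sup>2 / real n) \<longlonglongrightarrow> \<psi> a + 0"
    by (intro tendsto_add tendsto_const lim_const_over_n)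
  have "(\<lambda>n. (b - a) / real n) \<longlonglongrightarrow> 0"
    by (rule lim_const_over_n)
  then have "\<forall>\<^sub>F n in sequentially. (b - a) / real n < \<delta>"
    using \<open>0 < \<delta>\<close> by (rule order_tendstoD)
  then have "\<forall>\<^sub>F n in sequentially. \<psi> b \<le> \<psi> a + C * (b - a)\<^sup>2 / real n"
    using eventually_gt_at_top[of 0] by eventually_elim (intro bound, auto)
  with lim show ?thesis
    using tendsto_lowerbound[of _ "\<psi> a + 0" sequentially "\<psi> b"] by simp
qed

definition bounded_measurable_on :: "real \<Rightarrow> real \<Rightarrow> (real \<Rightarrow> 'a::euclidean_space) \<Rightarrow> bool" where
  "bounded_measurable_on a b \<phi> \<longleftrightarrow>
     \<phi> \<in> borel_measurable (lebesgue_on {a..b}) \<and> bounded (\<phi> ` {a..b})"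

text \<open>
  No pointwise derivative is required: \<open>F\<close> is an indefinite integral of \<open>\<phi>\<close>. Boundedness makes
  \<open>F\<close> Lipschitz, on which the product rule below relies.
\<close>

definition primitive_on :: "real \<Rightarrow> real \<Rightarrow> (real \<Rightarrow> 'a::euclidean_space) \<Rightarrow> (real \<Rightarrow> 'a) \<Rightarrow> bool" where
  "primitive_on a b F \<phi> \<longleftrightarrow> bounded_measurable_on a b \<phi> \<and>
     (\<forall>s t. a \<le> s \<and> s \<le> t \<and> t \<le> b \<longrightarrow> (\<phi> has_integral (F t - F s)) {s..t})"

lemma primitive_on_has_integral:
  "\<lbrakk>primitive_on a b F \<phi>; a \<le> s; s \<le> t; t \<le> b\<rbrakk> \<Longrightarrow> (\<phi> has_integral (F t - F s)) {s..t}"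
  by (simp add: primitive_on_def)

lemma bounded_measurable_on_continuous:
  "continuous_on {a..b} \<phi> \<Longrightarrow> bounded_measurable_on a b \<phi>"
  unfolding bounded_measurable_on_def
  by (intro conjI continuous_imp_measurable_on_sets_lebesgue compact_imp_bounded
        compact_continuous_image) auto

lemma bounded_measurable_on_add:
  assumes "bounded_measurable_on a b \<phi>" "bounded_measurable_on a b \<gamma>"
  shows "bounded_measurable_on a b (\<lambda>s. \<phi> s + \<gamma> s)"
  using assms unfolding bounded_measurable_on_def by (auto intro: bounded_plus_comp)

lemma bounded_measurable_on_diff:
  assumes "bounded_measurable_on a b \<phi>" "bounded_measurable_on a b \<gamma>"
  shows "bounded_measurable_on a b (\<lambda>s. \<phi> s - \<gamma> s)"
  using assms unfolding bounded_measurable_on_def by (auto intro: bounded_minus_comp)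

lemma bounded_measurable_on_bound:
  assumes "bounded_measurable_on a b \<phi>"
  obtains C where "0 \<le> C" "\<And>s. \<lbrakk>a \<le> s; s \<le> b\<rbrakk> \<Longrightarrow> norm (\<phi> s) \<le> C"
proof -
  obtain C where "0 < C" "\<forall>x\<in>\<phi> ` {a..b}. norm x \<le> C"
    using assms unfolding bounded_measurable_on_def bounded_pos by blast
  then show ?thesis by (intro that[of C]) auto
qed

lemma bounded_measurable_onI:
  assumes "\<phi> \<in> borel_measurable (lebesgue_on {a..b})" "\<And>s. \<lbrakk>a \<le> s; s \<le> b\<rbrakk> \<Longrightarrow> norm (\<phi> s) \<le> C"
  shows "bounded_measurable_on a b \<phi>"
  unfolding bounded_measurable_on_def using assms by (auto intro!: boundedI)

lemma bounded_measurable_on_scaleR: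
  assumes "bounded_measurable_on a b \<phi>" "bounded_measurable_on a b \<gamma>"
  shows "bounded_measurable_on a b (\<lambda>s. \<phi> s *\<^sub>R \<gamma> s)"
proof -
  obtain C where C: "\<And>s. \<lbrakk>a \<le> s; s \<le> b\<rbrakk> \<Longrightarrow> norm (\<phi> s) \<le> C"
    using bounded_measurable_on_bound[OF assms(1)] by blast
  obtain D where D: "\<And>s. \<lbrakk>a \<le> s; s \<le> b\<rbrakk> \<Longrightarrow> norm (\<gamma> s) \<le> D"
    using bounded_measurable_on_bound[OF assms(2)] by blast
  have "norm (\<phi> s *\<^sub>R \<gamma> s) \<le> C * D" if "a \<le> s" "s \<le> b" for s
    unfolding norm_scaleR using C[OF that] D[OF that] by (intro mult_mono) auto
  then show ?thesis
    using assms by (intro bounded_measurable_onI) (auto simp: bounded_measurable_on_def)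
qed

lemma bounded_measurable_on_integrable:
  assumes "bounded_measurable_on a b \<phi>"
  shows "integrable (lebesgue_on {a..b}) \<phi>"
proof -
  obtain C where "\<And>s. \<lbrakk>a \<le> s; s \<le> b\<rbrakk> \<Longrightarrow> norm (\<phi> s) \<le> C"
    using bounded_measurable_on_bound[OF assms] by blast
  then show ?thesis
    using assms unfolding bounded_measurable_on_def
    by (intro finite_measure.integrable_const_bound[where B = C] finite_measure_lebesgue_on) auto
qed

lemma bounded_measurable_on_integrable_on:
  assumes "bounded_measurable_on a b \<phi>" "a \<le> s" "t \<le> b"
  shows "\<phi> integrable_on {s..t}"
proof -
  have "\<phi> integrable_on {a..b}"
    using has_integral_integral_lebesgue_on[OF bounded_measurable_on_integrable[OF assms(1)]]
    by (rule has_integral_integrable) simp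
  then show ?thesis
    by (rule integrable_on_subinterval) (use assms in auto)
qed

lemma primitive_on_Lipschitz:
  assumes "primitive_on a b F \<phi>"
  obtains C where "0 \<le> C" "\<And>s. s \<in> {a..b} \<Longrightarrow> norm (\<phi> s) \<le> C"
    "\<And>s t. \<lbrakk>a \<le> s; s \<le> t; t \<le> b\<rbrakk> \<Longrightarrow> norm (F t - F s) \<le> C * (t - s)"
proof -
  obtain C where C: "0 \<le> C" "\<And>s. \<lbrakk>a \<le> s; s \<le> b\<rbrakk> \<Longrightarrow> norm (\<phi> s) \<le> C"
    using assms bounded_measurable_on_bound unfolding primitive_on_def by blast
  have "norm (F t - F s) \<le> C * (t - s)" if "a \<le> s" "s \<le> t" "t \<le> b" for s t
  proof -
    have "(\<phi> has_integral (F t - F s)) (cbox s t)"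
      using assms that unfolding primitive_on_def by auto
    then have "norm (F t - F s) \<le> C * measure lborel (cbox s t)"
      using C that by (intro has_integral_bound) auto
    with that show ?thesis by simp
  qed
  with C show ?thesis by (intro that[of C]) auto
qed

lemma primitive_on_continuous:
  assumes "primitive_on a b F \<phi>"
  shows "continuous_on {a..b} F"
proof -
  obtain C where C: "0 \<le> C" "\<And>s t. \<lbrakk>a \<le> s; s \<le> t; t \<le> b\<rbrakk> \<Longrightarrow> norm (F t - F s) \<le> C * (t - s)"
    using primitive_on_Lipschitz[OF assms] by metis
  have "C-lipschitz_on {a..b} F"
  proof (rule lipschitz_onI)
    fix s t assume "s \<in> {a..b}" "t \<in> {a..b}"
    then show "dist (F s) (F t) \<le> C * dist s t"
      using C(2)[of s t] C(2)[of t s] by (cases "s \<le> t") (auto simp: dist_norm norm_minus_commute)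
  qed (use C in simp)
  then show ?thesis by (rule lipschitz_on_continuous_on)
qed

lemma primitive_on_bounded_measurable:
  assumes "primitive_on a b F \<phi>"
  shows "bounded_measurable_on a b F" "bounded_measurable_on a b \<phi>"
  using assms bounded_measurable_on_continuous[OF primitive_on_continuous[OF assms]]
  by (auto simp: primitive_on_def)

text \<open>
  The defect \<open>F t - F s - integral {s..t} \<phi>\<close> is additive over adjacent intervals, so a quadratic
  bound forces it to vanish.
\<close>

lemma primitive_onI_quadratic:
  assumes \<phi>: "bounded_measurable_on a b \<phi>"
    and approx: "\<And>s t. \<lbrakk>a \<le> s; s \<le> t; t \<le> b\<rbrakk> \<Longrightarrow> norm (F t - F s - integral {s..t} \<phi>) \<le> C * (t - s)\<^sup>2"
  shows "primitive_on a b F \<phi>"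
  unfolding primitive_on_def
proof (intro conjI allI impI \<phi>)
  fix s t assume st: "a \<le> s \<and> s \<le> t \<and> t \<le> b"
  have int: "\<phi> integrable_on {s'..t'}" if "a \<le> s'" "t' \<le> b" for s' t'
    using bounded_measurable_on_integrable_on[OF \<phi>] that by simp
  define E where "E t = norm (F t - F s - integral {s..t} \<phi>)" for t
  have "E t \<le> E s"
  proof (rule le_of_quadratic_increments[of s t 1])
    fix s' t' assume *: "s \<le> s'" "s' \<le> t'" "t' \<le> t"
    have "integral {s..t'} \<phi> = integral {s..s'} \<phi> + integral {s'..t'} \<phi>"
      using * st by (intro Henstock_Kurzweil_Integration.integral_combine[symmetric] int) auto
    then have "F t' - F s - integral {s..t'} \<phi>
        = (F s' - F s - integral {s..s'} \<phi>) + (F t' - F s' - integral {s'..t'} \<phi>)"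
      by simp
    then have "E t' \<le> E s' + norm (F t' - F s' - integral {s'..t'} \<phi>)"
      unfolding E_def by (metis norm_triangle_ineq)
    also have "\<dots> \<le> E s' + C * (t' - s')\<^sup>2"
      using * st by (intro add_left_mono approx) auto
    finally show "E t' \<le> E s' + C * (t' - s')\<^sup>2" .
  qed (use st in auto)
  then have "integral {s..t} \<phi> = F t - F s"
    by (simp add: E_def)
  then show "(\<phi> has_integral (F t - F s)) {s..t}"
    using int[of s t] st by (metis integrable_integral)
qed

lemma primitive_on_integral:
  assumes \<phi>: "bounded_measurable_on a b \<phi>"
  shows "primitive_on a b (\<lambda>t. integral {a..t} \<phi>) \<phi>"
proof (rule primitive_onI_quadratic[OF \<phi>, of _ 0])
  fix s t assume st: "a \<le> s" "s \<le> t" "t \<le> b"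
  have "integral {a..s} \<phi> + integral {s..t} \<phi> = integral {a..t} \<phi>"
    using st by (intro Henstock_Kurzweil_Integration.integral_combine
        bounded_measurable_on_integrable_on[OF \<phi>]) auto
  then show "norm (integral {a..t} \<phi> - integral {a..s} \<phi> - integral {s..t} \<phi>) \<le> 0 * (t - s)\<^sup>2"
    by (simp add: algebra_simps)
qed

lemma primitive_on_const: "primitive_on a b (\<lambda>_. c) (\<lambda>_. 0)"
  unfolding primitive_on_def by (auto intro!: bounded_measurable_on_continuous continuous_intros)

lemma primitive_on_shift: "primitive_on a b (\<lambda>t. t - c) (\<lambda>_. 1 :: real)"
  unfolding primitive_on_def
proof (intro conjI allI impI bounded_measurable_on_continuous continuous_intros)
  fix s t assume "a \<le> s \<and> s \<le> t \<and> t \<le> b"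
  then show "((\<lambda>_. 1) has_integral t - c - (s - c)) {s..t}"
    using has_integral_const_real[of "1 :: real" s t] by simp
qed

lemma primitive_on_add:
  assumes "primitive_on a b F \<phi>" "primitive_on a b G \<gamma>"
  shows "primitive_on a b (\<lambda>s. F s + G s) (\<lambda>s. \<phi> s + \<gamma> s)"
  using assms unfolding primitive_on_def
  by (auto simp: add_diff_add intro: bounded_measurable_on_add has_integral_add)

lemma primitive_on_diff:
  assumes "primitive_on a b F \<phi>" "primitive_on a b G \<gamma>"
  shows "primitive_on a b (\<lambda>s. F s - G s) (\<lambda>s. \<phi> s - \<gamma> s)"
  unfolding primitive_on_def
proof (intro conjI allI impI)
  show "bounded_measurable_on a b (\<lambda>s. \<phi> s - \<gamma> s)"
    using assms by (auto simp: primitive_on_def intro: bounded_measurable_on_diff)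
  fix s t assume "a \<le> s \<and> s \<le> t \<and> t \<le> b"
  then have "((\<lambda>s. \<phi> s - \<gamma> s) has_integral (F t - F s) - (G t - G s)) {s..t}"
    using assms by (auto simp: primitive_on_def intro: has_integral_diff)
  then show "((\<lambda>s. \<phi> s - \<gamma> s) has_integral F t - G t - (F s - G s)) {s..t}"
    by (simp add: algebra_simps)
qed

text \<open>
  The product rule without differentiation: freezing \<open>G\<close> at the left and \<open>F\<close> at the right end of a
  short interval makes the increment of the product an exact integral, and as both functions are
  Lipschitz, unfreezing changes the integrand by a multiple of the length of the interval.
\<close>

lemma primitive_on_scaleR:
  fixes F :: "real \<Rightarrow> real" and G :: "real \<Rightarrow> 'a::euclidean_space"
  assumes F: "primitive_on a b F \<phi>" and G: "primitive_on a b G \<gamma>"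
  shows "primitive_on a b (\<lambda>s. F s *\<^sub>R G s) (\<lambda>s. \<phi> s *\<^sub>R G s + F s *\<^sub>R \<gamma> s)"
proof -
  obtain C where C: "0 \<le> C" "\<And>s. s \<in> {a..b} \<Longrightarrow> norm (\<phi> s) \<le> C"
    "\<And>s t. \<lbrakk>a \<le> s; s \<le> t; t \<le> b\<rbrakk> \<Longrightarrow> norm (F t - F s) \<le> C * (t - s)"
    using primitive_on_Lipschitz[OF F] by metis
  obtain D where D: "0 \<le> D" "\<And>s. s \<in> {a..b} \<Longrightarrow> norm (\<gamma> s) \<le> D"
    "\<And>s t. \<lbrakk>a \<le> s; s \<le> t; t \<le> b\<rbrakk> \<Longrightarrow> norm (G t - G s) \<le> D * (t - s)"
    using primitive_on_Lipschitz[OF G] by metis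
  have bm: "bounded_measurable_on a b (\<lambda>s. \<phi> s *\<^sub>R G s + F s *\<^sub>R \<gamma> s)"
    by (intro bounded_measurable_on_add bounded_measurable_on_scaleR
        primitive_on_bounded_measurable[OF F] primitive_on_bounded_measurable[OF G])
  show ?thesis
  proof (rule primitive_onI_quadratic[OF bm, of _ "C * D"])
    fix s t assume st: "a \<le> s" "s \<le> t" "t \<le> b"
    \<comment> \<open>the density with \<open>G\<close> frozen at \<open>s\<close> and \<open>F\<close> at \<open>t\<close>, minus the true one\<close>
    let ?\<rho> = "\<lambda>u. \<phi> u *\<^sub>R (G s - G u) + (F t - F u) *\<^sub>R \<gamma> u"
    have "((\<lambda>u. \<phi> u *\<^sub>R G s) has_integral (F t - F s) *\<^sub>R G s) {s..t}"
      using F st by (intro has_integral_scaleR_left) (auto simp: primitive_on_def)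
    moreover have "((\<lambda>u. F t *\<^sub>R \<gamma> u) has_integral F t *\<^sub>R (G t - G s)) {s..t}"
      using G st by (intro has_integral_cmul) (auto simp: primitive_on_def)
    moreover have "((\<lambda>s. \<phi> s *\<^sub>R G s + F s *\<^sub>R \<gamma> s) has_integral
        integral {s..t} (\<lambda>s. \<phi> s *\<^sub>R G s + F s *\<^sub>R \<gamma> s)) {s..t}"
      using bounded_measurable_on_integrable_on[OF bm st(1,3)] by (rule integrable_integral)
    ultimately have "((\<lambda>u. (\<phi> u *\<^sub>R G s + F t *\<^sub>R \<gamma> u) - (\<phi> u *\<^sub>R G u + F u *\<^sub>R \<gamma> u)) has_integral
        ((F t - F s) *\<^sub>R G s + F t *\<^sub>R (G t - G s)) - integral {s..t} (\<lambda>s. \<phi> s *\<^sub>R G s + F s *\<^sub>R \<gamma> s)) {s..t}"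
      by (intro has_integral_diff has_integral_add)
    then have int: "(?\<rho> has_integral
        (F t *\<^sub>R G t - F s *\<^sub>R G s - integral {s..t} (\<lambda>s. \<phi> s *\<^sub>R G s + F s *\<^sub>R \<gamma> s))) (cbox s t)"
      by (simp add: algebra_simps)
    have "norm (?\<rho> u) \<le> C * D * (t - s)" if u: "u \<in> cbox s t" for u
    proof -
      have "norm (\<phi> u *\<^sub>R (G s - G u)) \<le> C * (D * (u - s))"
        unfolding norm_scaleR norm_minus_commute[of "G s"]
        using C D st u by (intro mult_mono) auto
      moreover have "norm ((F t - F u) *\<^sub>R \<gamma> u) \<le> (C * (t - u)) * D"
        unfolding norm_scaleR using C D(2)[of u] C(3)[of u t] st u by (intro mult_mono) auto
      ultimately have "norm (?\<rho> u) \<le> C * (D * (u - s)) + (C * (t - u)) * D"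
        by (meson add_mono norm_triangle_le)
      also have "\<dots> = C * D * (t - s)" by (simp add: algebra_simps)
      finally show ?thesis .
    qed
    then have "norm (F t *\<^sub>R G t - F s *\<^sub>R G s - integral {s..t} (\<lambda>s. \<phi> s *\<^sub>R G s + F s *\<^sub>R \<gamma> s))
        \<le> C * D * (t - s) * measure lborel (cbox s t)"
      using C(1) D(1) st by (intro has_integral_bound[OF _ int]) auto
    with st show "norm (F t *\<^sub>R G t - F s *\<^sub>R G s - integral {s..t} (\<lambda>s. \<phi> s *\<^sub>R G s + F s *\<^sub>R \<gamma> s))
        \<le> C * D * (t - s)\<^sup>2"
      by (simp add: power2_eq_square mult.assoc)
  qed
qed

lemma primitive_on_absolutely_continuous:
  assumes AC: "absolutely_continuous_fun a b F" and N: "negligible N"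
    and deriv: "\<And>s. s \<in> {a..b} - N \<Longrightarrow> (F has_vector_derivative \<phi> s) (at s within {a..b})"
    and \<phi>: "bounded_measurable_on a b \<phi>"
  shows "primitive_on a b F \<phi>"
  unfolding primitive_on_def
proof (intro conjI allI impI \<phi>)
  fix s t assume st: "a \<le> s \<and> s \<le> t \<and> t \<le> b"
  show "(\<phi> has_integral (F t - F s)) {s..t}"
  proof (rule absolutely_continuous_has_integral[OF _ _ N])
    show "absolutely_continuous_fun s t F"
      unfolding absolutely_continuous_fun_def
    proof (intro allI impI)
      fix e :: real assume "0 < e"
      then obtain \<delta> where "0 < \<delta>" and \<delta>: "\<forall>(m::nat) c d.
        (\<forall>i<m. a \<le> c i \<and> c i \<le> d i \<and> d i \<le> b) \<and> disjoint_family_on (\<lambda>i. {c i<..<d i}) {..<m} \<and>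
        (\<Sum>i<m. d i - c i) < \<delta> \<longrightarrow> (\<Sum>i<m. dist (F (c i)) (F (d i))) < e"
        using AC unfolding absolutely_continuous_fun_def by blast
      then show "\<exists>\<delta>>0. \<forall>(m::nat) c d.
        (\<forall>i<m. s \<le> c i \<and> c i \<le> d i \<and> d i \<le> t) \<and> disjoint_family_on (\<lambda>i. {c i<..<d i}) {..<m} \<and>
        (\<Sum>i<m. d i - c i) < \<delta> \<longrightarrow> (\<Sum>i<m. dist (F (c i)) (F (d i))) < e"
        using st by (intro exI[of _ \<delta>]) (meson order_trans)
    qed
    fix u assume "u \<in> {s..t} - N"
    then show "(F has_vector_derivative \<phi> u) (at u within {s..t})"
      using st by (intro has_vector_derivative_within_subset[OF deriv]) auto
  qed (use st in auto)
qed

text \<open>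
  The Lipschitz bound along \<open>X\<close> makes the composition absolutely continuous, and the ordinary chain
  rule holds wherever \<open>X\<close> is differentiable, that is, almost everywhere.
\<close>

lemma primitive_on_compose:
  fixes X :: "real \<Rightarrow> 'a::euclidean_space" and \<Phi> :: "'a \<Rightarrow> 'b::euclidean_space"
  assumes X: "primitive_on a b X \<xi>" and N: "negligible N"
    and deriv: "\<And>s. s \<in> {a..b} - N \<Longrightarrow> (X has_vector_derivative \<xi> s) (at s within {a..b})"
    and \<Phi>: "\<And>z. (\<Phi> has_derivative D z) (at z)"
    and lip: "\<And>s t. \<lbrakk>s \<in> {a..b}; t \<in> {a..b}\<rbrakk> \<Longrightarrow> norm (\<Phi> (X t) - \<Phi> (X s)) \<le> M * norm (X t - X s)"
    and D: "bounded_measurable_on a b (\<lambda>s. D (X s) (\<xi> s))"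
  shows "primitive_on a b (\<lambda>s. \<Phi> (X s)) (\<lambda>s. D (X s) (\<xi> s))"
proof (rule primitive_on_absolutely_continuous[OF _ N _ D])
  obtain C where C: "0 \<le> C" "\<And>s t. \<lbrakk>a \<le> s; s \<le> t; t \<le> b\<rbrakk> \<Longrightarrow> norm (X t - X s) \<le> C * (t - s)"
    using primitive_on_Lipschitz[OF X] by metis
  show "absolutely_continuous_fun a b (\<lambda>s. \<Phi> (X s))"
  proof (rule Lipschitz_imp_absolutely_continuous)
    fix s t assume st: "a \<le> s" "s \<le> t" "t \<le> b"
    have "dist (\<Phi> (X s)) (\<Phi> (X t)) \<le> M * norm (X t - X s)"
      using lip[of s t] st by (simp add: dist_norm norm_minus_commute)
    also have "\<dots> \<le> \<bar>M\<bar> * (C * (t - s))"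
      using C(2)[OF st] by (intro mult_mono) auto
    finally show "dist (\<Phi> (X s)) (\<Phi> (X t)) \<le> \<bar>M\<bar> * C * (t - s)" by simp
  qed
  fix s assume "s \<in> {a..b} - N"
  then have "((\<lambda>s. \<Phi> (X s)) has_derivative (\<lambda>h. D (X s) (h *\<^sub>R \<xi> s))) (at s within {a..b})"
    using has_derivative_compose[OF deriv[unfolded has_vector_derivative_def] \<Phi>] by blast
  moreover have "D (X s) (h *\<^sub>R \<xi> s) = h *\<^sub>R D (X s) (\<xi> s)" for h
    using \<Phi>[of "X s"] has_derivative_linear linear_scale by blast
  ultimately show "((\<lambda>s. \<Phi> (X s)) has_vector_derivative D (X s) (\<xi> s)) (at s within {a..b})"
    by (simp add: has_vector_derivative_def)
qed

text \<open>
  Integrals of vectors satisfy the triangle inequality in the supremum norm because they do in each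
  coordinate.
\<close>

lemma infnorm_primitive_le:
  assumes F: "primitive_on a b F \<phi>" and "a \<le> s" "s \<le> t" "t \<le> b"
    and \<phi>: "\<And>u. u \<in> {s..t} \<Longrightarrow> infnorm (\<phi> u) \<le> \<beta> u"
    and \<beta>: "(\<beta> has_integral J) {s..t}"
  shows "infnorm (F t - F s) \<le> J"
proof -
  have "\<bar>(F t - F s) \<bullet> i\<bar> \<le> J" if i: "i \<in> Basis" for i
  proof -
    have "(\<phi> has_integral (F t - F s)) {s..t}"
      using assms by (auto simp: primitive_on_def)
    then have "((\<lambda>u. \<phi> u \<bullet> i) has_integral (F t - F s) \<bullet> i) {s..t}"
      using has_integral_linear[OF _ bounded_linear_inner_left[of i]] by (auto simp: o_def)
    moreover have "\<bar>\<phi> u \<bullet> i\<bar> \<le> \<beta> u" if "u \<in> {s..t}" for u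
      using \<phi>[OF that] Basis_le_infnorm[OF i, of "\<phi> u"] by simp
    ultimately show ?thesis
      using \<beta> integral_norm_bound_integral[of "\<lambda>u. \<phi> u \<bullet> i" "{s..t}" \<beta>]
      by (auto simp: integral_unique integrable_on_def)
  qed
  then show ?thesis by (simp add: infnorm_Max)
qed

lemma has_integral_shift_power:
  assumes "a \<le> (b::real)"
  shows "((\<lambda>s. (s - a) ^ n) has_integral (b - a) ^ Suc n / real (Suc n)) {a..b}"
proof -
  have "((\<lambda>s. (s - a) ^ n) has_integral (b - a) ^ Suc n / real (Suc n) - (a - a) ^ Suc n / real (Suc n)) {a..b}"
  proof (rule fundamental_theorem_of_calculus[OF assms])
    fix s
    have "((\<lambda>s. (s - a) ^ Suc n / real (Suc n)) has_real_derivative (s - a) ^ n) (at s within {a..b})"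
      by (auto intro!: derivative_eq_intros simp del: of_nat_Suc power_Suc)
    then show "((\<lambda>s. (s - a) ^ Suc n / real (Suc n)) has_vector_derivative (s - a) ^ n) (at s within {a..b})"
      by (simp add: has_real_derivative_iff_has_vector_derivative)
  qed
  then show ?thesis by simp
qed

lemma has_integral_abs_midpoint:
  assumes "a \<le> (b::real)"
  shows "((\<lambda>s. \<bar>s - (a + (b - a) / 2)\<bar>) has_integral (b - a)\<^sup>2 / 4) {a..b}"
proof -
  define m where "m = a + (b - a) / 2"
  have m: "a \<le> m" "m \<le> b" "b - m = (b - a) / 2" "m - a = (b - a) / 2"
    using assms by (auto simp: m_def field_simps)
  have "((\<lambda>s. \<bar>s - m\<bar>) has_integral (b - m) ^ Suc 1 / real (Suc 1)) {m..b}"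
    by (rule has_integral_eq[OF _ has_integral_shift_power[OF m(2), of 1]]) auto
  then have "((\<lambda>s. \<bar>s - m\<bar>) has_integral (b - m)\<^sup>2 / 2) {m..b}"
    by (simp add: power2_eq_square)
  moreover have "((\<lambda>s. \<bar>s - m\<bar>) has_integral (m - a)\<^sup>2 / 2) {a..m}"
  proof -
    have "((\<lambda>s. (m - a) - (s - a) ^ 1) has_integral (m - a) * (m - a) - (m - a) ^ Suc 1 / real (Suc 1)) {a..m}"
      using has_integral_const_real[of "m - a" a m] m(1)
      by (intro has_integral_diff has_integral_shift_power) (simp_all add: mult.commute)
    then have "((\<lambda>s. \<bar>s - m\<bar>) has_integral (m - a) * (m - a) - (m - a) ^ Suc 1 / real (Suc 1)) {a..m}"
      by (rule has_integral_eq[rotated]) auto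
    then show ?thesis
      by (simp add: power2_eq_square)
  qed
  ultimately have "((\<lambda>s. \<bar>s - m\<bar>) has_integral (m - a)\<^sup>2 / 2 + (b - m)\<^sup>2 / 2) {a..b}"
    by (intro has_integral_combine[OF m(1,2)])
  moreover have "(m - a)\<^sup>2 / 2 + (b - m)\<^sup>2 / 2 = (b - a)\<^sup>2 / 4"
    unfolding m(3,4) by (simp add: power_divide)
  ultimately show ?thesis
    unfolding m_def[symmetric] by (simp only:)
qed

section \<open>Bounds in the supremum norm\<close>

lemma infnorm_real [simp]: "infnorm (x::real) = \<bar>x\<bar>"
  by (simp add: infnorm_Max)

lemma infnorm_add_le: "infnorm x \<le> c \<Longrightarrow> infnorm y \<le> d \<Longrightarrow> infnorm (x + y) \<le> c + d"
  using infnorm_triangle[of x y] by linarith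

lemma infnorm_diff_le: "infnorm x \<le> c \<Longrightarrow> infnorm y \<le> d \<Longrightarrow> infnorm (x - y) \<le> c + d"
  using infnorm_add_le[of x c "- y" d] by (simp add: infnorm_neg)

lemma infnorm_scaleR_le: "\<bar>k\<bar> \<le> c \<Longrightarrow> infnorm x \<le> d \<Longrightarrow> infnorm (k *\<^sub>R x) \<le> c * d"
  unfolding infnorm_mul by (intro mult_mono infnorm_pos_le) auto

lemma infnorm_matrix_vector_le:
  fixes Q :: "real ^ 'n ^ 'n"
  assumes rows: "\<And>k. (\<Sum>i\<in>UNIV. \<bar>Q $ k $ i\<bar>) \<le> c"
  shows "infnorm (Q *v u) \<le> c * infnorm u"
  unfolding infnorm_le_iff
proof
  fix k
  have "\<bar>(Q *v u) $ k\<bar> \<le> (\<Sum>i\<in>UNIV. \<bar>Q $ k $ i * u $ i\<bar>)"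
    unfolding matrix_vector_mult_def by simp
  also have "\<dots> \<le> (\<Sum>i\<in>UNIV. \<bar>Q $ k $ i\<bar> * infnorm u)"
    by (intro sum_mono) (simp add: abs_mult mult_left_mono component_le_infnorm_cart)
  also have "\<dots> \<le> c * infnorm u"
    unfolding sum_distrib_right[symmetric] by (intro mult_right_mono rows infnorm_pos_le)
  finally show "\<bar>(Q *v u) $ k\<bar> \<le> c * infnorm u" .
qed

lemma matrix_infnorm_row_le:
  fixes Q :: "real ^ 'n ^ 'n"
  assumes "matrix_infnorm Q \<le> c"
  shows "(\<Sum>i\<in>UNIV. \<bar>Q $ k $ i\<bar>) \<le> c"
  using assms unfolding matrix_infnorm_eq_Max by (subst (asm) Max_le_iff) auto

text \<open>
  Once \<open>d\<close> is so small that the diagonal of \<open>mat 1 + d *\<^sub>R Q\<close> is nonnegative, its row sums are those of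
  the logarithmic norm. The smallness depends on \<open>Q\<close> only through \<open>L\<close>, hence is uniform along a
  trajectory.
\<close>

lemma infnorm_Euler_matrix_le:
  fixes Q :: "real ^ 'n ^ 'n"
  assumes "matrix_infnorm Q \<le> L" "log_infnorm Q \<le> \<Lambda>" "0 \<le> d" "d * L \<le> 1"
  shows "infnorm (u + d *\<^sub>R (Q *v u)) \<le> (1 + d * \<Lambda>) * infnorm u"
proof -
  have "(\<Sum>i\<in>UNIV. \<bar>(mat 1 + d *\<^sub>R Q) $ k $ i\<bar>) \<le> 1 + d * \<Lambda>" for k
  proof -
    have "\<bar>Q $ k $ k\<bar> \<le> (\<Sum>i\<in>UNIV. \<bar>Q $ k $ i\<bar>)"
      by (rule member_le_sum) auto
    also have "\<dots> \<le> L" by (rule matrix_infnorm_row_le[OF assms(1)])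
    finally have "d * \<bar>Q $ k $ k\<bar> \<le> d * L" using \<open>0 \<le> d\<close> by (rule mult_left_mono)
    with assms have "\<bar>d * Q $ k $ k\<bar> \<le> 1" by (simp add: abs_mult)
    then have diag: "\<bar>1 + d * Q $ k $ k\<bar> = 1 + d * Q $ k $ k" by linarith
    have off: "(\<Sum>i\<in>UNIV - {k}. \<bar>(mat 1 + d *\<^sub>R Q) $ k $ i\<bar>) = d * (\<Sum>i\<in>UNIV - {k}. \<bar>Q $ k $ i\<bar>)"
      unfolding sum_distrib_left using \<open>0 \<le> d\<close> by (intro sum.cong) (auto simp: mat_def abs_mult)
    have "Q $ k $ k + (\<Sum>i\<in>UNIV - {k}. \<bar>Q $ k $ i\<bar>) \<le> \<Lambda>"
      using assms(2) unfolding log_infnorm_eq_Max by (subst (asm) Max_le_iff) auto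
    then have "d * (Q $ k $ k + (\<Sum>i\<in>UNIV - {k}. \<bar>Q $ k $ i\<bar>)) \<le> d * \<Lambda>"
      using \<open>0 \<le> d\<close> by (rule mult_left_mono)
    moreover have "(mat 1 + d *\<^sub>R Q) $ k $ k = 1 + d * Q $ k $ k"
      by (simp add: mat_def)
    ultimately show ?thesis
      using sum.remove[of UNIV k "\<lambda>i. \<bar>(mat 1 + d *\<^sub>R Q) $ k $ i\<bar>"] off diag
      by (simp only: finite UNIV_I distrib_left)
  qed
  from infnorm_matrix_vector_le[OF this, of u] show ?thesis
    by (simp add: matrix_vector_mult_add_rdistrib scaleR_matrix_vector_assoc)
qed

text \<open>
  The supremum defining the norm is only meaningful as it is finite, which follows by comparison
  with the Euclidean norm.
\<close>

lemma infnorm_bilinear_le: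
  fixes p :: "real ^ 'n \<Rightarrow> real ^ 'n \<Rightarrow> real ^ 'n"
  assumes "bounded_bilinear p" "bilinear_infnorm p \<le> c"
  shows "infnorm (p u1 u2) \<le> c * (infnorm u1 * infnorm u2)"
proof -
  obtain C where C: "0 \<le> C" "\<And>u1 u2. norm (p u1 u2) \<le> norm u1 * norm u2 * C"
    using bounded_bilinear.nonneg_bounded[OF assms(1)] by blast
  define D where "D = sqrt DIM(real ^ 'n)"
  have D: "norm u \<le> D * infnorm u" for u :: "real ^ 'n"
    unfolding D_def by (rule norm_le_infnorm)
  have "0 \<le> D" by (simp add: D_def)
  have bound: "infnorm (p u1 u2) \<le> C * D * D * (infnorm u1 * infnorm u2)" for u1 u2
  proof -
    have "infnorm (p u1 u2) \<le> norm u1 * norm u2 * C"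
      using infnorm_le_norm C(2) by (rule order_trans)
    also have "\<dots> \<le> (D * infnorm u1) * (D * infnorm u2) * C"
      using C(1) D \<open>0 \<le> D\<close> by (intro mult_mono) (auto intro!: mult_nonneg_nonneg infnorm_pos_le)
    finally show ?thesis by (simp add: mult_ac)
  qed
  have quot: "infnorm (p u1 u2) / (infnorm u1 * infnorm u2) \<le> C * D * D" for u1 u2
  proof (cases "infnorm u1 * infnorm u2 = 0")
    case False
    then have "0 < infnorm u1 * infnorm u2"
      using infnorm_pos_le[of u1] infnorm_pos_le[of u2] by (simp add: less_le)
    then show ?thesis using bound[of u1 u2] by (simp add: divide_le_eq)
  next
    case True
    show ?thesis unfolding True using C(1) \<open>0 \<le> D\<close> by simp
  qed
  have "bdd_above (range (\<lambda>(u1, u2). infnorm (p u1 u2) / (infnorm u1 * infnorm u2)))"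
    by (rule bdd_aboveI2[where M = "C * D * D"]) (use quot in auto)
  from cSUP_upper[OF UNIV_I this, of "(u1, u2)"]
  have le: "infnorm (p u1 u2) / (infnorm u1 * infnorm u2) \<le> c"
    using assms(2) unfolding bilinear_infnorm_def by simp
  show ?thesis
  proof (cases "infnorm u1 * infnorm u2 = 0")
    case True
    show ?thesis using bound[of u1 u2] unfolding True by simp
  next
    case False
    then have "0 < infnorm u1 * infnorm u2"
      using infnorm_pos_le[of u1] infnorm_pos_le[of u2] by (simp add: less_le)
    then show ?thesis using le by (simp add: divide_le_eq)
  qed
qed

text \<open>
  The mean value theorem is applied to each coordinate on the segment; every coordinate may have its
  own intermediate point, which the supremum norm tolerates without loss in the constant.
\<close>

lemma infnorm_diff_le_of_derivative:
  fixes \<Phi> :: "'a::euclidean_space \<Rightarrow> 'b::euclidean_space"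
  assumes B: "convex B" "x \<in> B" "y \<in> B"
    and deriv: "\<And>z. z \<in> B \<Longrightarrow> (\<Phi> has_derivative D z) (at z)"
    and bound: "\<And>z u. z \<in> B \<Longrightarrow> infnorm (D z u) \<le> c * infnorm u"
  shows "infnorm (\<Phi> x - \<Phi> y) \<le> c * infnorm (x - y)"
proof -
  have "\<bar>(\<Phi> x - \<Phi> y) \<bullet> i\<bar> \<le> c * infnorm (x - y)" if i: "i \<in> Basis" for i
  proof -
    define \<gamma> where "\<gamma> \<tau> = y + \<tau> *\<^sub>R (x - y)" for \<tau> :: real
    have \<gamma>: "\<gamma> \<tau> \<in> B" if "\<tau> \<in> {0..1}" for \<tau>
    proof -
      have "\<gamma> \<tau> = (1 - \<tau>) *\<^sub>R y + \<tau> *\<^sub>R x" by (simp add: \<gamma>_def algebra_simps)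
      then show ?thesis using B that by (auto intro: convexD)
    qed
    have "((\<lambda>\<tau>. \<Phi> (\<gamma> \<tau>) \<bullet> i) has_derivative (\<lambda>h. D (\<gamma> \<tau>) (h *\<^sub>R (x - y)) \<bullet> i)) (at \<tau> within {0..1})"
      if "0 \<le> \<tau>" "\<tau> \<le> 1" for \<tau>
    proof -
      have "(\<gamma> has_derivative (\<lambda>h. h *\<^sub>R (x - y))) (at \<tau> within {0..1})"
        unfolding \<gamma>_def by (auto intro!: derivative_eq_intros)
      from has_derivative_compose[OF this deriv[OF \<gamma>]] that show ?thesis
        by (intro has_derivative_inner_left) auto
    qed
    from mvt_simple[OF zero_less_one this] obtain \<tau> where \<tau>: "\<tau> \<in> {0<..<1}"
      "\<Phi> (\<gamma> 1) \<bullet> i - \<Phi> (\<gamma> 0) \<bullet> i = D (\<gamma> \<tau>) ((1 - 0) *\<^sub>R (x - y)) \<bullet> i"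
      by blast
    then have "\<bar>(\<Phi> x - \<Phi> y) \<bullet> i\<bar> = \<bar>D (\<gamma> \<tau>) (x - y) \<bullet> i\<bar>"
      by (simp add: \<gamma>_def inner_diff_left)
    also have "\<dots> \<le> infnorm (D (\<gamma> \<tau>) (x - y))"
      by (rule Basis_le_infnorm[OF i])
    also have "\<dots> \<le> c * infnorm (x - y)"
      using \<tau>(1) by (intro bound \<gamma>) auto
    finally show ?thesis .
  qed
  then show ?thesis by (simp add: infnorm_Max)
qed

text \<open>
  Passes from the Jacobian and the iterated Frechet derivative to derivatives with values in bounded
  linear maps, for which continuity and the product rule are at hand. The arguments of the second
  derivative change places, harmlessly for the bound.
\<close>

lemma C2_infnorm_bounds:
  fixes f :: "real ^ 'n \<Rightarrow> real ^ 'n"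
  assumes "C2 f"
  obtains f' :: "real ^ 'n \<Rightarrow> (real ^ 'n) \<Rightarrow>\<^sub>L (real ^ 'n)" and f'' :: "real ^ 'n \<Rightarrow> (real ^ 'n) \<Rightarrow>\<^sub>L (real ^ 'n) \<Rightarrow>\<^sub>L (real ^ 'n)"
  where "\<And>z. (f has_derivative blinfun_apply (f' z)) (at z)"
    and "\<And>z. (f' has_derivative blinfun_apply (f'' z)) (at z)"
    and "continuous_on UNIV f''"
    and "\<And>z u. blinfun_apply (f' z) u = jacobian f (at z) *v u"
    and "\<And>z c u. matrix_infnorm (jacobian f (at z)) \<le> c \<Longrightarrow> infnorm (f' z u) \<le> c * infnorm u"
    and "\<And>z c u1 u2. bilinear_infnorm (second_derivative f z) \<le> c
           \<Longrightarrow> infnorm (f'' z u1 u2) \<le> c * (infnorm u1 * infnorm u2)"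
proof -
  obtain f' f'' where f': "\<And>z. (f has_derivative blinfun_apply (f' z)) (at z)"
    and f'': "\<And>z. (f' has_derivative blinfun_apply (f'' z)) (at z)"
    and cont: "continuous_on UNIV f''"
    using assms unfolding C2_def by blast
  have "f differentiable (at z)" for z
    using f' by (rule differentiableI)
  then have "(f has_derivative (\<lambda>u. jacobian f (at z) *v u)) (at z)" for z
    by (simp add: jacobian_works[symmetric])
  then have jac: "blinfun_apply (f' z) u = jacobian f (at z) *v u" for z u
    using f' has_derivative_unique by metis
  have fd: "frechet_derivative f (at z) = blinfun_apply (f' z)" for z
    using frechet_derivative_at[OF f'] by simp
  have "((\<lambda>z'. blinfun_apply (f' z') u1) has_derivative (\<lambda>u2. blinfun_apply (f'' z u2) u1)) (at z)" for z u1
    using bounded_linear.has_derivative[OF bounded_bilinear.bounded_linear_left[OF bounded_bilinear_blinfun_apply] f'']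
    by blast
  then have "frechet_derivative (\<lambda>z'. blinfun_apply (f' z') u1) (at z) = (\<lambda>u2. blinfun_apply (f'' z u2) u1)" for z u1
    by (rule frechet_derivative_at[symmetric])
  then have sd: "second_derivative f z = (\<lambda>u1 u2. f'' z u2 u1)" for z
    by (simp add: second_derivative_def fd fun_eq_iff)
  have "bounded_bilinear (\<lambda>u2 u1. f'' z u2 u1)" for z
    by (rule bounded_bilinear.comp1[OF bounded_bilinear_blinfun_apply blinfun.bounded_linear_right])
  then have bil: "bounded_bilinear (second_derivative f z)" for z
    unfolding sd by (rule bounded_bilinear.flip)
  have "infnorm (f' z u) \<le> c * infnorm u" if "matrix_infnorm (jacobian f (at z)) \<le> c" for z c u
    unfolding jac by (rule infnorm_matrix_vector_le[OF matrix_infnorm_row_le[OF that]])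
  moreover have "infnorm (f'' z u1 u2) \<le> c * (infnorm u1 * infnorm u2)"
    if "bilinear_infnorm (second_derivative f z) \<le> c" for z c u1 u2
    using infnorm_bilinear_le[OF bil that, of u2 u1] by (simp add: sd mult.commute)
  ultimately show ?thesis
    using f' f'' cont jac by (intro that[of f' f'']) blast+
qed

text \<open>
  This is applied with \<open>\<phi>\<close> and \<open>\<gamma>\<close> among the two vector fields \<open>f\<close>, \<open>g\<close>: the maps \<open>Df f\<close>, \<open>Df g\<close>,
  \<open>Dg f\<close> and \<open>Dg g\<close> appear when the fields are differentiated along a trajectory.
\<close>

lemma apply_has_derivative:
  assumes "(\<phi>' has_derivative blinfun_apply (\<phi>'' z)) (at z)" "(\<gamma> has_derivative blinfun_apply (\<gamma>' z)) (at z)"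
  shows "((\<lambda>z. blinfun_apply (\<phi>' z) (\<gamma> z)) has_derivative (\<lambda>u. \<phi>' z (\<gamma>' z u) + \<phi>'' z u (\<gamma> z))) (at z)"
  using bounded_bilinear.FDERIV[OF bounded_bilinear_blinfun_apply assms] .

lemma infnorm_apply_derivative_le:
  fixes \<phi>' :: "real ^ 'n \<Rightarrow> (real ^ 'n) \<Rightarrow>\<^sub>L (real ^ 'n)"
  assumes \<phi>': "\<And>u. infnorm (\<phi>' z u) \<le> c1 * infnorm u"
    and \<phi>'': "\<And>u1 u2. infnorm (\<phi>'' z u1 u2) \<le> c2 * (infnorm u1 * infnorm u2)"
    and \<gamma>: "infnorm (\<gamma> z) \<le> d0" and \<gamma>': "\<And>u. infnorm (\<gamma>' z u) \<le> d1 * infnorm u"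
    and "0 \<le> c1" "0 \<le> c2"
  shows "infnorm (\<phi>' z (\<gamma>' z u) + \<phi>'' z u (\<gamma> z)) \<le> (c1 * d1 + c2 * d0) * infnorm u"
proof -
  have "infnorm (\<phi>' z (\<gamma>' z u)) \<le> c1 * (d1 * infnorm u)"
    using \<phi>' by (rule order_trans) (intro mult_left_mono \<gamma>' \<open>0 \<le> c1\<close>)
  moreover have "infnorm (\<phi>'' z u (\<gamma> z)) \<le> c2 * (infnorm u * d0)"
    using \<phi>'' by (rule order_trans) (intro mult_left_mono \<gamma> infnorm_pos_le \<open>0 \<le> c2\<close>)
  ultimately show ?thesis
    using infnorm_add_le by (fastforce simp: algebra_simps)
qed

section \<open>Growth of the distance between two trajectories\<close>

lemma phi_ge: "1 - \<bar>s\<bar> \<le> phi s"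
proof -
  consider "s = 0" | "0 < s" | "s < 0" by linarith
  then show ?thesis
  proof cases
    case 2
    have "s \<le> exp s - 1" using exp_ge_add_one_self[of s] by linarith
    then have "1 \<le> (exp s - 1) / s" using 2 by (simp add: le_divide_eq)
    moreover have "phi s = (exp s - 1) / s" using 2 by (simp add: phi_def)
    ultimately show ?thesis using 2 by linarith
  next
    case 3
    have "1 + (- s) \<le> exp (- s)" by (rule exp_ge_add_one_self)
    then have "exp s * (1 - s) \<le> exp s * exp (- s)"
      by (intro mult_left_mono) auto
    also have "\<dots> = 1" by (simp add: exp_minus)
    also have "1 \<le> (1 + s + s\<^sup>2) * (1 - s)"
    proof -
      have "(1 + s + s\<^sup>2) * (1 - s) = 1 + (- s) * s\<^sup>2"
        by (simp add: algebra_simps power2_eq_square)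
      then show ?thesis using 3 mult_nonneg_nonneg[of "- s" "s\<^sup>2"] by simp
    qed
    finally have "exp s \<le> 1 + s + s\<^sup>2"
      using 3 by (subst (asm) mult_le_cancel_right) auto
    then have "1 + s \<le> (exp s - 1) / s"
      using 3 by (simp add: le_divide_eq power2_eq_square algebra_simps)
    moreover have "phi s = (exp s - 1) / s" using 3 by (simp add: phi_def)
    ultimately show ?thesis using 3 by linarith
  qed (simp add: phi_def)
qed

lemma phi_pos: "0 < phi s"
proof -
  have "0 < (exp s - 1) / s" if "s \<noteq> 0"
    using that by (cases "0 < s") (auto intro: divide_neg_neg)
  then show ?thesis by (simp add: phi_def)
qed

lemma phi_le_exp: "phi s \<le> exp \<bar>s\<bar>"
proof -
  consider "s = 0" | "0 < s" | "s < 0" by linarith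
  then show ?thesis
  proof cases
    case 2
    have "exp s * (1 + (- s)) \<le> exp s * exp (- s)"
      by (intro mult_left_mono exp_ge_add_one_self) auto
    also have "\<dots> = 1" by (simp add: exp_minus)
    finally have "exp s - 1 \<le> exp s * s" by (simp add: algebra_simps)
    with 2 show ?thesis by (simp add: phi_def divide_le_eq)
  next
    case 3
    have "s \<le> exp s - 1" using exp_ge_add_one_self[of s] by linarith
    with 3 have "(exp s - 1) / s \<le> 1" by (simp add: divide_le_eq)
    also have "1 \<le> exp \<bar>s\<bar>" by simp
    finally show ?thesis using 3 by (simp add: phi_def)
  qed (simp add: phi_def)
qed

text \<open>
  The function \<open>s * phi (\<Lambda> * s)\<close> solves \<open>E' = \<Lambda> E + 1\<close>, \<open>E(0) = 0\<close>; this is its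
  flow property.
\<close>

lemma mult_phi_add:
  "(s + d) * phi (\<Lambda> * (s + d)) = exp (\<Lambda> * d) * (s * phi (\<Lambda> * s)) + d * phi (\<Lambda> * d)"
proof (cases "\<Lambda> = 0")
  case False
  have closed: "s * phi (\<Lambda> * s) = (exp (\<Lambda> * s) - 1) / \<Lambda>" for s
    using False by (simp add: phi_def)
  show ?thesis
    unfolding closed using False by (simp add: field_simps exp_add)
qed (simp add: phi_def)

lemma mult_phi_mono:
  assumes "0 \<le> s" "s \<le> t"
  shows "s * phi (\<Lambda> * s) \<le> t * phi (\<Lambda> * t)"
proof -
  have "t * phi (\<Lambda> * t) = (t - s) * phi (\<Lambda> * (t - s)) + exp (\<Lambda> * (t - s)) * (s * phi (\<Lambda> * s))"
    using mult_phi_add[of s "t - s" \<Lambda>] by simp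
  moreover have "s * phi (\<Lambda> * s) + (t - s) * phi (\<Lambda> * (t - s)) * exp (\<Lambda> * s)
      = t * phi (\<Lambda> * t)"
    using mult_phi_add[of "t - s" s \<Lambda>] by simp
  moreover have "0 \<le> (t - s) * phi (\<Lambda> * (t - s)) * exp (\<Lambda> * s)"
    using assms phi_pos[of "\<Lambda> * (t - s)"] by simp
  ultimately show ?thesis by linarith
qed

text \<open>
  Gronwall's inequality with the logarithmic norm: \<open>z' = \<alpha> + e\<close>, where an Euler step along \<open>\<alpha>\<close>
  expands \<open>z\<close> by at most \<open>1 + d \<Lambda>\<close> and \<open>e\<close> is bounded by \<open>c\<close>. As the norm is not
  differentiable and \<open>\<Lambda>\<close> may be negative, the comparison with \<open>c E\<close> is made over short
  steps: after the integrating factor \<open>exp (- \<Lambda> (s - a))\<close> the difference of the two sides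
  increases over a step of length \<open>d\<close> by at most a multiple of \<open>d\<^sup>2\<close>.
\<close>

lemma infnorm_growth_le:
  fixes z :: "real \<Rightarrow> 'a::euclidean_space"
  assumes z: "primitive_on a b z (\<lambda>s. \<alpha> s + e s)" and "z a = 0"
    and e: "\<And>s. s \<in> {a..b} \<Longrightarrow> infnorm (e s) \<le> c"
    and \<alpha>: "\<And>s t. \<lbrakk>a \<le> s; s \<le> t; t \<le> b\<rbrakk> \<Longrightarrow> infnorm (\<alpha> t - \<alpha> s) \<le> M * (t - s)"
    and "0 < \<delta>"
    and Euler: "\<And>s d. \<lbrakk>s \<in> {a..b}; 0 \<le> d; d \<le> \<delta>\<rbrakk>
      \<Longrightarrow> infnorm (z s + d *\<^sub>R \<alpha> s) \<le> (1 + d * \<Lambda>) * infnorm (z s)"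
    and t: "t \<in> {a..b}"
  shows "infnorm (z t) \<le> c * ((t - a) * phi (\<Lambda> * (t - a)))"
proof -
  have "0 \<le> c" using e[OF t] infnorm_pos_le[of "e t"] by linarith
  define E where "E s = (s - a) * phi (\<Lambda> * (s - a))" for s
  define \<psi> where "\<psi> s = exp (- \<Lambda> * (s - a)) * (infnorm (z s) - c * E s)" for s
  define C where "C = exp (\<bar>\<Lambda>\<bar> * (b - a)) * (c * \<bar>\<Lambda>\<bar> + \<bar>M\<bar>)"
  have "\<psi> t \<le> \<psi> a"
  proof (rule le_of_quadratic_increments[of a t \<delta> _ C])
    fix s s' assume ss': "a \<le> s" "s \<le> s'" "s' \<le> t" "s' - s \<le> \<delta>"
    define d where "d = s' - s"
    have d: "0 \<le> d" "d \<le> \<delta>" "s' = s + d" using ss' by (auto simp: d_def)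
    have s: "s \<in> {a..b}" using ss' t by auto
    \<comment> \<open>the deviation of \<open>z\<close> from the Euler step started at \<open>s\<close>\<close>
    have "primitive_on a b (\<lambda>u. z u - (u - s) *\<^sub>R \<alpha> s)
        (\<lambda>u. (\<alpha> u + e u) - (1 *\<^sub>R \<alpha> s + (u - s) *\<^sub>R 0))"
      by (intro primitive_on_diff primitive_on_scaleR primitive_on_shift primitive_on_const z)
    then have "infnorm ((z s' - (s' - s) *\<^sub>R \<alpha> s) - (z s - (s - s) *\<^sub>R \<alpha> s)) \<le> (\<bar>M\<bar> * d + c) * d"
    proof (rule infnorm_primitive_le)
      fix u assume u: "u \<in> {s..s'}"
      have "infnorm (\<alpha> u - \<alpha> s) \<le> M * (u - s)" using u ss' t by (intro \<alpha>) auto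
      also have "\<dots> \<le> \<bar>M\<bar> * d" using u by (intro mult_mono) (auto simp: d_def)
      finally have "infnorm ((\<alpha> u - \<alpha> s) + e u) \<le> \<bar>M\<bar> * d + c"
        using e[of u] u ss' t by (intro order_trans[OF infnorm_triangle] add_mono) auto
      then show "infnorm (\<alpha> u + e u - (1 *\<^sub>R \<alpha> s + (u - s) *\<^sub>R 0)) \<le> \<bar>M\<bar> * d + c"
        by (simp add: algebra_simps)
    next
      show "((\<lambda>_. \<bar>M\<bar> * d + c) has_integral (\<bar>M\<bar> * d + c) * d) {s..s'}"
        using has_integral_const_real[of "\<bar>M\<bar> * d + c" s s'] ss' by (simp add: d_def mult.commute)
    qed (use ss' t in auto)
    then have "infnorm (z s' - (z s + d *\<^sub>R \<alpha> s)) \<le> (\<bar>M\<bar> * d + c) * d"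
      by (simp add: d_def algebra_simps)
    moreover have "infnorm (z s') \<le> infnorm (z s + d *\<^sub>R \<alpha> s) + infnorm (z s' - (z s + d *\<^sub>R \<alpha> s))"
      using infnorm_triangle[of "z s + d *\<^sub>R \<alpha> s" "z s' - (z s + d *\<^sub>R \<alpha> s)"] by simp
    moreover have "infnorm (z s + d *\<^sub>R \<alpha> s) \<le> exp (\<Lambda> * d) * infnorm (z s)"
      using Euler[OF s d(1,2)]
        mult_right_mono[OF exp_ge_add_one_self[of "\<Lambda> * d"] infnorm_pos_le[of "z s"]]
      unfolding mult.commute[of d] by linarith
    ultimately have step: "infnorm (z s') \<le> exp (\<Lambda> * d) * infnorm (z s) + (\<bar>M\<bar> * d + c) * d"
      by linarith
    have E: "E s' = exp (\<Lambda> * d) * E s + d * phi (\<Lambda> * d)"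
      using mult_phi_add[of "s - a" d \<Lambda>] by (simp add: E_def d(3) algebra_simps)
    have "c * (d * (1 - \<bar>\<Lambda> * d\<bar>)) \<le> c * (d * phi (\<Lambda> * d))"
      using \<open>0 \<le> c\<close> d(1) by (intro mult_left_mono phi_ge) auto
    then have "infnorm (z s') - c * E s' \<le> exp (\<Lambda> * d) * (infnorm (z s) - c * E s) + (c * \<bar>\<Lambda>\<bar> + \<bar>M\<bar>) * d\<^sup>2"
      using step d(1) by (simp add: E abs_mult power2_eq_square algebra_simps)
    then have "\<psi> s' \<le> exp (- \<Lambda> * (s' - a)) * (exp (\<Lambda> * d) * (infnorm (z s) - c * E s) + (c * \<bar>\<Lambda>\<bar> + \<bar>M\<bar>) * d\<^sup>2)"
      unfolding \<psi>_def by (intro mult_left_mono) auto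
    also have "\<dots> = \<psi> s + exp (- \<Lambda> * (s' - a)) * ((c * \<bar>\<Lambda>\<bar> + \<bar>M\<bar>) * d\<^sup>2)"
      unfolding \<psi>_def distrib_left mult.assoc[symmetric] exp_add[symmetric]
      by (simp add: d(3) algebra_simps)
    also have "\<dots> \<le> \<psi> s + exp (\<bar>\<Lambda>\<bar> * (b - a)) * ((c * \<bar>\<Lambda>\<bar> + \<bar>M\<bar>) * d\<^sup>2)"
    proof -
      have "- \<Lambda> * (s' - a) \<le> \<bar>\<Lambda>\<bar> * (b - a)"
        using ss' t by (intro mult_mono) auto
      then show ?thesis
        using \<open>0 \<le> c\<close> by (intro add_left_mono mult_right_mono) auto
    qed
    finally show "\<psi> s' \<le> \<psi> s + C * (s' - s)\<^sup>2"
      by (simp add: C_def d_def mult.assoc)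
  qed (use t \<open>0 < \<delta>\<close> in auto)
  then have "exp (- \<Lambda> * (t - a)) * (infnorm (z t) - c * E t) \<le> 0"
    using \<open>z a = 0\<close> by (simp add: \<psi>_def E_def infnorm_0)
  then have "infnorm (z t) - c * E t \<le> 0"
    by (simp add: mult_le_0_iff)
  then show ?thesis by (simp add: E_def)
qed

section \<open>Functions of a solution\<close>

lemma bounded_measurable_on_input:
  assumes "input V a b v"
  shows "bounded_measurable_on a b v"
  using assms unfolding input_def by (intro bounded_measurable_onI[where C = V]) auto

lemma solution_primitive_on:
  fixes f g :: "real ^ 'n \<Rightarrow> real ^ 'n"
  assumes sol: "solution f g v a b x" and v: "bounded_measurable_on a b v"
    and f: "continuous_on UNIV f" and g: "continuous_on UNIV g"
  obtains N where "negligible N"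
    "\<And>s. s \<in> {a..b} - N \<Longrightarrow> (x has_vector_derivative f (x s) + v s *\<^sub>R g (x s)) (at s within {a..b})"
    "primitive_on a b x (\<lambda>s. f (x s) + v s *\<^sub>R g (x s))"
proof -
  have AC: "absolutely_continuous_fun a b x"
    using sol by (simp add: solution_def)
  then have x: "continuous_on {a..b} x"
    by (rule absolutely_continuous_imp_continuous_on)
  obtain N where N: "N \<in> null_sets (lebesgue_on {a..b})"
    "{s \<in> space (lebesgue_on {a..b}).
       \<not> (x has_vector_derivative f (x s) + v s *\<^sub>R g (x s)) (at s within {a..b})} \<subseteq> N"
    using sol unfolding solution_def by (auto elim!: AE_E3 simp: eventually_ae_filter)
  then have neg: "negligible N"
    by (simp add: negligible_iff_null_sets null_sets_restrict_space)
  have deriv: "(x has_vector_derivative f (x s) + v s *\<^sub>R g (x s)) (at s within {a..b})"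
    if "s \<in> {a..b} - N" for s
    using N(2) that by auto
  have "bounded_measurable_on a b (\<lambda>s. f (x s) + v s *\<^sub>R g (x s))"
    by (intro bounded_measurable_on_add bounded_measurable_on_scaleR v bounded_measurable_on_continuous
        continuous_on_compose2[OF f x] continuous_on_compose2[OF g x]) auto
  then have "primitive_on a b x (\<lambda>s. f (x s) + v s *\<^sub>R g (x s))"
    by (intro primitive_on_absolutely_continuous[OF AC neg] deriv)
  with neg deriv show ?thesis by (rule that)
qed

text \<open>
  The density is measurable because the linearity of \<open>D z\<close> splits it into a continuous function plus
  \<open>v\<close> times another one.
\<close>

lemma primitive_on_along_solution:
  fixes f g \<Phi> :: "real ^ 'n \<Rightarrow> real ^ 'n"
  assumes sol: "solution f g v a b x" and v: "bounded_measurable_on a b v"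
    and f: "continuous_on UNIV f" and g: "continuous_on UNIV g"
    and \<Phi>: "\<And>z. (\<Phi> has_derivative D z) (at z)"
    and D: "continuous_on UNIV (\<lambda>p. D (fst p) (snd p))"
    and B: "convex B" "\<And>s. s \<in> {a..b} \<Longrightarrow> x s \<in> B"
    and bound: "\<And>z u. z \<in> B \<Longrightarrow> infnorm (D z u) \<le> c * infnorm u"
  shows "primitive_on a b (\<lambda>s. \<Phi> (x s)) (\<lambda>s. D (x s) (f (x s) + v s *\<^sub>R g (x s)))"
proof -
  obtain N where N: "negligible N"
    and deriv: "\<And>s. s \<in> {a..b} - N \<Longrightarrow>
      (x has_vector_derivative f (x s) + v s *\<^sub>R g (x s)) (at s within {a..b})"
    and x: "primitive_on a b x (\<lambda>s. f (x s) + v s *\<^sub>R g (x s))"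
    by (rule solution_primitive_on[OF sol v f g]) blast
  note contx = primitive_on_continuous[OF x]
  have contD: "continuous_on {a..b} (\<lambda>s. D (x s) (\<gamma> (x s)))" if "continuous_on UNIV \<gamma>" for \<gamma>
    using continuous_on_compose2[OF D continuous_on_Pair[OF contx continuous_on_compose2[OF that contx]]]
    by simp
  have lin: "linear (D z)" for z
    using \<Phi> has_derivative_linear by blast
  have D_bm: "bounded_measurable_on a b (\<lambda>s. D (x s) (f (x s) + v s *\<^sub>R g (x s)))"
    unfolding linear_add[OF lin] linear_scale[OF lin]
    by (intro bounded_measurable_on_add bounded_measurable_on_scaleR v
        bounded_measurable_on_continuous contD f g)
  show ?thesis
  proof (rule primitive_on_compose[OF x N _ \<Phi> _ D_bm])
    fix s t assume st: "s \<in> {a..b}" "t \<in> {a..b}"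
    let ?c = "sqrt DIM(real ^ 'n)"
    have "norm (\<Phi> (x t) - \<Phi> (x s)) \<le> ?c * infnorm (\<Phi> (x t) - \<Phi> (x s))"
      by (rule norm_le_infnorm)
    also have "\<dots> \<le> ?c * (c * infnorm (x t - x s))"
      using st by (intro mult_left_mono infnorm_diff_le_of_derivative[OF B(1) B(2) B(2) \<Phi> bound]) auto
    also have "\<dots> \<le> ?c * (\<bar>c\<bar> * norm (x t - x s))"
      by (intro mult_left_mono mult_mono infnorm_le_norm infnorm_pos_le) auto
    finally show "norm (\<Phi> (x t) - \<Phi> (x s)) \<le> (?c * \<bar>c\<bar>) * norm (x t - x s)" by simp
  qed (rule deriv)
qed

section \<open>Two inputs with equal moments\<close>

text \<open>
  The hypotheses on one step \<open>[a, b]\<close>, with derivatives as bounded linear maps and all norm bounds in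
  the form in which they are applied. The logarithmic norm enters only through \<open>Euler_le\<close>.
\<close>

locale two_inputs =
  fixes f g :: "real ^ 'n \<Rightarrow> real ^ 'n"
    and f' g' :: "real ^ 'n \<Rightarrow> (real ^ 'n) \<Rightarrow>\<^sub>L (real ^ 'n)"
    and f'' g'' :: "real ^ 'n \<Rightarrow> (real ^ 'n) \<Rightarrow>\<^sub>L (real ^ 'n) \<Rightarrow>\<^sub>L (real ^ 'n)"
    and B :: "(real ^ 'n) set"
    and K K1 L L1 H H1 \<Lambda> V1 r a b :: real
    and v w :: "real \<Rightarrow> real" and x y :: "real \<Rightarrow> real ^ 'n"
  assumes f': "\<And>z. (f has_derivative blinfun_apply (f' z)) (at z)"
    and g': "\<And>z. (g has_derivative blinfun_apply (g' z)) (at z)"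
    and f'': "\<And>z. (f' has_derivative blinfun_apply (f'' z)) (at z)"
    and g'': "\<And>z. (g' has_derivative blinfun_apply (g'' z)) (at z)"
    and cont_f'': "continuous_on UNIV f''" and cont_g'': "continuous_on UNIV g''"
    and convex_B: "convex B"
    and f_le: "\<And>z. z \<in> B \<Longrightarrow> infnorm (f z) \<le> K"
    and g_le: "\<And>z. z \<in> B \<Longrightarrow> infnorm (g z) \<le> K1"
    and f'_le: "\<And>z u. z \<in> B \<Longrightarrow> infnorm (f' z u) \<le> L * infnorm u"
    and g'_le: "\<And>z u. z \<in> B \<Longrightarrow> infnorm (g' z u) \<le> L1 * infnorm u"
    and f''_le: "\<And>z u1 u2. z \<in> B \<Longrightarrow> infnorm (f'' z u1 u2) \<le> H * (infnorm u1 * infnorm u2)"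
    and g''_le: "\<And>z u1 u2. z \<in> B \<Longrightarrow> infnorm (g'' z u1 u2) \<le> H1 * (infnorm u1 * infnorm u2)"
    and Euler_le: "\<And>z u d. \<lbrakk>z \<in> B; 0 \<le> d; d * L \<le> 1\<rbrakk>
      \<Longrightarrow> infnorm (u + d *\<^sub>R f' z u) \<le> (1 + d * \<Lambda>) * infnorm u"
    and less: "a < b" and V1: "0 < V1"
    and input_v: "input V1 a b v" and input_w: "input (r * V1) a b w"
    and moment0: "integral {a..b} (\<lambda>s. v s - w s) = 0"
    and moment1: "integral {a..b} (\<lambda>s. (s - (a + (b - a) / 2)) * (v s - w s)) = 0"
    and solution_x: "solution f g v a b x" and solution_y: "solution f g w a b y"
    and start: "x a = y a"
    and x_in_B: "\<And>s. s \<in> {a..b} \<Longrightarrow> x s \<in> B" and y_in_B: "\<And>s. s \<in> {a..b} \<Longrightarrow> y s \<in> B"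
begin

text \<open>
  The trajectories supply a point of \<open>B\<close> at which each bound dominates a norm.
\<close>

lemma constants_nonneg:
  "0 \<le> K" "0 \<le> K1" "0 \<le> L" "0 \<le> L1" "0 \<le> H" "0 \<le> H1" "0 \<le> r"
proof -
  let ?z = "x a" and ?u = "axis undefined 1 :: real ^ 'n"
  have z: "?z \<in> B" using x_in_B less by simp
  have "0 < infnorm ?u" by (simp add: infnorm_pos_lt axis_eq_0_iff)
  then have u: "0 < infnorm ?u" "0 < infnorm ?u * infnorm ?u" by simp_all
  show "0 \<le> K" "0 \<le> K1"
    using f_le[OF z] g_le[OF z] infnorm_pos_le order_trans by blast+
  have "0 \<le> L * infnorm ?u" "0 \<le> L1 * infnorm ?u"
    using f'_le[OF z] g'_le[OF z] infnorm_pos_le order_trans by blast+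
  with u show "0 \<le> L" "0 \<le> L1" by (simp_all add: zero_le_mult_iff)
  have "0 \<le> H * (infnorm ?u * infnorm ?u)" "0 \<le> H1 * (infnorm ?u * infnorm ?u)"
    using f''_le[OF z] g''_le[OF z] infnorm_pos_le order_trans by blast+
  with u show "0 \<le> H" "0 \<le> H1" by (metis zero_le_mult_iff not_le)+
  have "\<bar>w a\<bar> \<le> r * V1" using input_w less by (simp add: input_def)
  then have "0 \<le> r * V1" by linarith
  with V1 show "0 \<le> r" by (simp add: zero_le_mult_iff)
qed

lemma v_le: "s \<in> {a..b} \<Longrightarrow> \<bar>v s\<bar> \<le> V1" and w_le: "s \<in> {a..b} \<Longrightarrow> \<bar>w s\<bar> \<le> r * V1"
  using input_v input_w by (auto simp: input_def)

lemma v_diff_w_le: "s \<in> {a..b} \<Longrightarrow> \<bar>v s - w s\<bar> \<le> (1 + r) * V1"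
  using v_le[of s] w_le[of s] by (simp add: algebra_simps)

lemmas bm_v = bounded_measurable_on_input[OF input_v]
lemmas bm_w = bounded_measurable_on_input[OF input_w]

lemma continuous_fields:
  "continuous_on UNIV f" "continuous_on UNIV g" "continuous_on UNIV f'" "continuous_on UNIV g'"
  using f' g' f'' g'' has_derivative_continuous by (blast intro: continuous_at_imp_continuous_on)+

abbreviation x_dot :: "real \<Rightarrow> real ^ 'n" where "x_dot s \<equiv> f (x s) + v s *\<^sub>R g (x s)"
abbreviation y_dot :: "real \<Rightarrow> real ^ 'n" where "y_dot s \<equiv> f (y s) + w s *\<^sub>R g (y s)"

lemma primitive_x: "primitive_on a b x x_dot"
  by (rule solution_primitive_on[OF solution_x bm_v continuous_fields(1,2)]) blast

lemma primitive_y: "primitive_on a b y y_dot"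
  by (rule solution_primitive_on[OF solution_y bm_w continuous_fields(1,2)]) blast

lemma x_dot_le: "s \<in> {a..b} \<Longrightarrow> infnorm (x_dot s) \<le> K + V1 * K1"
  by (intro infnorm_add_le infnorm_scaleR_le f_le g_le v_le x_in_B)

lemma y_dot_le: "s \<in> {a..b} \<Longrightarrow> infnorm (y_dot s) \<le> K + r * V1 * K1"
  by (intro infnorm_add_le infnorm_scaleR_le f_le g_le w_le y_in_B)

lemma f_Lipschitz: "\<lbrakk>p \<in> B; q \<in> B\<rbrakk> \<Longrightarrow> infnorm (f p - f q) \<le> L * infnorm (p - q)"
  using infnorm_diff_le_of_derivative[OF convex_B _ _ f' f'_le] .

lemma g_Lipschitz: "\<lbrakk>p \<in> B; q \<in> B\<rbrakk> \<Longrightarrow> infnorm (g p - g q) \<le> L1 * infnorm (p - q)"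
  using infnorm_diff_le_of_derivative[OF convex_B _ _ g' g'_le] .

text \<open>
  This bound is of first order only: it compares \<open>v g(x)\<close> with \<open>w g(y)\<close> by size and ignores the
  moment conditions.
\<close>

lemma trajectories_diff_le:
  assumes s: "s \<in> {a..b}"
  shows "infnorm (x s - y s) \<le> (1 + r) * (V1 * K1) * ((b - a) * phi (\<Lambda> * (b - a)))"
proof -
  let ?c = "(1 + r) * (V1 * K1)"
  let ?\<alpha> = "\<lambda>s. f (x s) - f (y s)" and ?e = "\<lambda>s. v s *\<^sub>R g (x s) - w s *\<^sub>R g (y s)"
  let ?Mx = "L * (K + V1 * K1)" and ?My = "L * (K + r * V1 * K1)"
  have move: "infnorm (X t - X s) \<le> c * (t - s)"
    if "primitive_on a b X \<xi>" "\<And>s. s \<in> {a..b} \<Longrightarrow> infnorm (\<xi> s) \<le> c" "a \<le> s" "s \<le> t" "t \<le> b"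
    for X :: "real \<Rightarrow> real ^ 'n" and \<xi> c s t
    using that has_integral_const_real[of c s t]
    by (intro infnorm_primitive_le[OF that(1) that(3-5), of "\<lambda>_. c"]) (auto simp: mult.commute)
  have "infnorm (x s - y s) \<le> ?c * ((s - a) * phi (\<Lambda> * (s - a)))"
  proof (rule infnorm_growth_le[where z = "\<lambda>s. x s - y s" and \<alpha> = ?\<alpha> and e = ?e and c = ?c and b = b
        and \<delta> = "1 / (L + 1)" and M = "?Mx + ?My"])
    have "(\<lambda>s. ?\<alpha> s + ?e s) = (\<lambda>s. x_dot s - y_dot s)" by (simp add: fun_eq_iff)
    then show "primitive_on a b (\<lambda>s. x s - y s) (\<lambda>s. ?\<alpha> s + ?e s)"
      using primitive_on_diff[OF primitive_x primitive_y] by simp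
    show "infnorm (?e s) \<le> ?c" if "s \<in> {a..b}" for s
    proof -
      have "infnorm (?e s) \<le> V1 * K1 + (r * V1) * K1"
        using that by (intro infnorm_diff_le infnorm_scaleR_le v_le w_le g_le x_in_B y_in_B)
      then show ?thesis by (simp add: algebra_simps)
    qed
    show "infnorm (?\<alpha> t - ?\<alpha> s) \<le> (?Mx + ?My) * (t - s)" if st: "a \<le> s" "s \<le> t" "t \<le> b" for s t
    proof -
      have "infnorm (f (x t) - f (x s)) \<le> L * ((K + V1 * K1) * (t - s))"
        using st constants_nonneg
        by (intro order_trans[OF f_Lipschitz] mult_left_mono move[OF primitive_x x_dot_le] x_in_B) auto
      moreover have "infnorm (f (y t) - f (y s)) \<le> L * ((K + r * V1 * K1) * (t - s))"
        using st constants_nonneg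
        by (intro order_trans[OF f_Lipschitz] mult_left_mono move[OF primitive_y y_dot_le] y_in_B) auto
      ultimately have "infnorm ((f (x t) - f (x s)) - (f (y t) - f (y s)))
          \<le> L * ((K + V1 * K1) * (t - s)) + L * ((K + r * V1 * K1) * (t - s))"
        by (rule infnorm_diff_le)
      then show ?thesis by (simp add: algebra_simps)
    qed
    show "infnorm (x s - y s + d *\<^sub>R ?\<alpha> s) \<le> (1 + d * \<Lambda>) * infnorm (x s - y s)"
      if "s \<in> {a..b}" "0 \<le> d" "d \<le> 1 / (L + 1)" for s d
    proof -
      have "d * L \<le> 1 / (L + 1) * L" using that constants_nonneg by (intro mult_right_mono) auto
      also have "\<dots> \<le> 1" using constants_nonneg by (simp add: divide_le_eq)
      finally have d: "d * L \<le> 1" .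
      have "infnorm ((x s + d *\<^sub>R f (x s)) - (y s + d *\<^sub>R f (y s))) \<le> (1 + d * \<Lambda>) * infnorm (x s - y s)"
        using that d by (intro infnorm_diff_le_of_derivative[OF convex_B x_in_B y_in_B _ Euler_le]
            has_derivative_add has_derivative_ident has_derivative_scaleR_right) (auto intro: f')
      then show ?thesis by (simp add: algebra_simps)
    qed
  qed (use s start constants_nonneg in auto)
  also have "\<dots> \<le> ?c * ((b - a) * phi (\<Lambda> * (b - a)))"
    using s constants_nonneg V1 by (intro mult_left_mono mult_phi_mono) auto
  finally show ?thesis .
qed

section \<open>Iterated integrals of the inputs\<close>

definition m :: real where "m = a + (b - a) / 2"

text \<open>
  The weights of the integrations by parts. \<open>U\<close>, \<open>P\<close>, \<open>W\<close> and \<open>R\<close> vanish at both ends of the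
  step (\<open>weights_start\<close>, \<open>weights_end\<close>); \<open>q\<close> vanishes only at the left end, and its value at the
  right end accounts for the term \<open>h r L'\<close>.
\<close>

definition p :: "real \<Rightarrow> real" where "p t = integral {a..t} v"
definition q :: "real \<Rightarrow> real" where "q t = integral {a..t} w"
definition U :: "real \<Rightarrow> real" where "U t = p t - q t"
definition W :: "real \<Rightarrow> real" where "W t = integral {a..t} U"
definition P :: "real \<Rightarrow> real" where "P t = integral {a..t} (\<lambda>s. (s - m) * (v s - w s))"
definition R :: "real \<Rightarrow> real" where "R t = ((p t)\<^sup>2 - (q t)\<^sup>2) / 2"

lemma primitive_p: "primitive_on a b p v" and primitive_q: "primitive_on a b q w"
  using primitive_on_integral[OF bm_v] primitive_on_integral[OF bm_w] by (simp_all add: p_def[abs_def] q_def[abs_def])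

lemma primitive_U: "primitive_on a b U (\<lambda>s. v s - w s)"
  using primitive_on_diff[OF primitive_p primitive_q] by (simp add: U_def[abs_def])

lemma primitive_W: "primitive_on a b W U"
  unfolding W_def[abs_def] by (intro primitive_on_integral primitive_on_bounded_measurable[OF primitive_U])

lemma primitive_P: "primitive_on a b P (\<lambda>s. (s - m) * (v s - w s))"
proof -
  have "bounded_measurable_on a b (\<lambda>s. (s - m) *\<^sub>R (v s - w s))"
    by (intro bounded_measurable_on_scaleR primitive_on_bounded_measurable[OF primitive_on_shift]
        primitive_on_bounded_measurable[OF primitive_U])
  then show ?thesis
    using primitive_on_integral unfolding P_def[abs_def] by simp
qed

lemma primitive_R: "primitive_on a b R (\<lambda>s. p s * v s - q s * w s)"
proof -
  have "primitive_on a b (\<lambda>s. (1 / 2 :: real) *\<^sub>R (p s *\<^sub>R p s - q s *\<^sub>R q s))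
      (\<lambda>s. 0 *\<^sub>R (p s *\<^sub>R p s - q s *\<^sub>R q s) + (1 / 2) *\<^sub>R
        ((v s *\<^sub>R p s + p s *\<^sub>R v s) - (w s *\<^sub>R q s + q s *\<^sub>R w s)))"
    by (intro primitive_on_scaleR primitive_on_const primitive_on_diff primitive_p primitive_q)
  moreover have "(\<lambda>s. (1 / 2 :: real) *\<^sub>R (p s *\<^sub>R p s - q s *\<^sub>R q s)) = R"
    by (simp add: R_def power2_eq_square fun_eq_iff)
  moreover have "(\<lambda>s. 0 *\<^sub>R (p s *\<^sub>R p s - q s *\<^sub>R q s) + (1 / 2) *\<^sub>R
        ((v s *\<^sub>R p s + p s *\<^sub>R v s) - (w s *\<^sub>R q s + q s *\<^sub>R w s))) = (\<lambda>s. p s * v s - q s * w s)"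
    by (simp add: fun_eq_iff algebra_simps)
  ultimately show ?thesis by simp
qed

lemma weights_start: "p a = 0" "q a = 0" "U a = 0" "W a = 0" "P a = 0" "R a = 0"
  by (simp_all add: p_def q_def U_def W_def P_def R_def)

text \<open>
  The zeroth moment gives \<open>U b = 0\<close>, and \<open>p b = q b\<close> gives \<open>R b = 0\<close>. Integrating \<open>(s - m) U\<close> by parts
  turns the first moment into \<open>W b = - P b = 0\<close>.
\<close>

lemma weights_end: "U b = 0" "P b = 0" "W b = 0" "R b = 0"
proof -
  have "(v has_integral p b) {a..b}" "(w has_integral q b) {a..b}"
    using primitive_on_has_integral[OF primitive_p, of a b] primitive_on_has_integral[OF primitive_q, of a b]
      less weights_start by simp_all
  then have "((\<lambda>s. v s - w s) has_integral (p b - q b)) {a..b}" by (rule has_integral_diff)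
  with moment0 show U: "U b = 0" by (simp add: integral_unique U_def)
  then show "R b = 0" by (simp add: R_def U_def)
  show P: "P b = 0" using moment1 by (simp add: P_def m_def)
  have "primitive_on a b (\<lambda>s. (s - m) *\<^sub>R U s - P s - W s)
      (\<lambda>s. (1 *\<^sub>R U s + (s - m) *\<^sub>R (v s - w s)) - (s - m) * (v s - w s) - U s)"
    by (intro primitive_on_scaleR primitive_on_diff primitive_on_shift primitive_U primitive_P primitive_W)
  then have "((\<lambda>_. 0 :: real) has_integral ((b - m) * U b - P b - W b) - ((a - m) * U a - P a - W a)) {a..b}"
    using primitive_on_has_integral[of a b _ _ a b] less by fastforce
  then have "((b - m) * U b - P b - W b) - ((a - m) * U a - P a - W a) = 0"
    by (rule has_integral_unique) (rule has_integral_0)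
  with U P show "W b = 0" by (simp add: weights_start)
qed

lemma abs_primitive_le:
  assumes "primitive_on a b F \<phi>" "F a = 0" "\<And>s. s \<in> {a..b} \<Longrightarrow> \<bar>\<phi> s\<bar> \<le> c * (s - a) ^ n"
    and t: "t \<in> {a..b}"
  shows "\<bar>F t\<bar> \<le> c * ((t - a) ^ Suc n / real (Suc n))"
proof -
  have "infnorm (F t - F a) \<le> c * ((t - a) ^ Suc n / real (Suc n))"
  proof (rule infnorm_primitive_le[OF assms(1)])
    show "((\<lambda>s. c * (s - a) ^ n) has_integral c * ((t - a) ^ Suc n / real (Suc n))) {a..t}"
      using t by (intro has_integral_mult_right has_integral_shift_power) auto
  qed (use t assms(3) in auto)
  then show ?thesis using assms(2) by simp
qed

lemma p_le: "t \<in> {a..b} \<Longrightarrow> \<bar>p t\<bar> \<le> V1 * (t - a)"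
  and q_le: "t \<in> {a..b} \<Longrightarrow> \<bar>q t\<bar> \<le> r * V1 * (t - a)"
  and U_le: "t \<in> {a..b} \<Longrightarrow> \<bar>U t\<bar> \<le> (1 + r) * V1 * (t - a)"
  using abs_primitive_le[OF primitive_p _ _, of V1 0 t] abs_primitive_le[OF primitive_q _ _, of "r * V1" 0 t]
    abs_primitive_le[OF primitive_U _ _, of "(1 + r) * V1" 0 t] v_le w_le v_diff_w_le weights_start
  by auto

lemma W_le: "t \<in> {a..b} \<Longrightarrow> \<bar>W t\<bar> \<le> (1 + r) * V1 * (t - a)\<^sup>2 / 2"
  using abs_primitive_le[OF primitive_W _ _, of "(1 + r) * V1" 1 t] U_le weights_start
  by (auto simp: numeral_2_eq_2)

lemma R_le:
  assumes t: "t \<in> {a..b}"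
  shows "\<bar>R t\<bar> \<le> (1 + r\<^sup>2) * V1\<^sup>2 * (t - a)\<^sup>2 / 2"
proof -
  have "(p t)\<^sup>2 \<le> (V1 * (t - a))\<^sup>2" "(q t)\<^sup>2 \<le> (r * V1 * (t - a))\<^sup>2"
    using power_mono[OF p_le[OF t], of 2] power_mono[OF q_le[OF t], of 2] by simp_all
  then have "((p t)\<^sup>2 + (q t)\<^sup>2) / 2 \<le> ((V1 * (t - a))\<^sup>2 + (r * V1 * (t - a))\<^sup>2) / 2"
    by (intro divide_right_mono add_mono) simp_all
  moreover have "\<bar>R t\<bar> \<le> ((p t)\<^sup>2 + (q t)\<^sup>2) / 2"
    by (simp add: R_def abs_le_iff)
  ultimately have "\<bar>R t\<bar> \<le> ((V1 * (t - a))\<^sup>2 + (r * V1 * (t - a))\<^sup>2) / 2"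
    by (rule order_trans[rotated])
  also have "\<dots> = (1 + r\<^sup>2) * V1\<^sup>2 * (t - a)\<^sup>2 / 2"
    unfolding power_mult_distrib by (simp add: distrib_right)
  finally show ?thesis .
qed

text \<open>
  Since \<open>P\<close> vanishes at both ends, \<open>|P t|\<close> is at most \<open>(1 + r) V1\<close> times the integral of \<open>|s - m|\<close>
  over the part of the step on either side of \<open>t\<close>, hence times half of that over the whole step.
\<close>

lemma P_le:
  assumes t: "t \<in> {a..b}"
  shows "\<bar>P t\<bar> \<le> (1 + r) * V1 * (b - a)\<^sup>2 / 8"
proof -
  let ?c = "(1 + r) * V1"
  have abs_m: "((\<lambda>s. \<bar>s - m\<bar>) has_integral (b - a)\<^sup>2 / 4) {a..b}"
    using has_integral_abs_midpoint[of a b] less by (simp add: m_def)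
  have part: "\<bar>P t' - P s'\<bar> \<le> ?c * integral {s'..t'} (\<lambda>s. \<bar>s - m\<bar>)"
    if "a \<le> s'" "s' \<le> t'" "t' \<le> b" for s' t'
  proof -
    have "infnorm (P t' - P s') \<le> ?c * integral {s'..t'} (\<lambda>s. \<bar>s - m\<bar>)"
    proof (rule infnorm_primitive_le[OF primitive_P that])
      show "((\<lambda>s. ?c * \<bar>s - m\<bar>) has_integral ?c * integral {s'..t'} (\<lambda>s. \<bar>s - m\<bar>)) {s'..t'}"
        by (intro has_integral_mult_right integrable_integral integrable_continuous_real continuous_intros)
      fix s assume "s \<in> {s'..t'}"
      then have "\<bar>v s - w s\<bar> * \<bar>s - m\<bar> \<le> ?c * \<bar>s - m\<bar>"
        using that by (intro mult_right_mono v_diff_w_le) auto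
      then show "infnorm ((s - m) * (v s - w s)) \<le> ?c * \<bar>s - m\<bar>"
        by (simp add: abs_mult mult.commute)
    qed
    then show ?thesis by simp
  qed
  have "integral {a..t} (\<lambda>s. \<bar>s - m\<bar>) + integral {t..b} (\<lambda>s. \<bar>s - m\<bar>) = (b - a)\<^sup>2 / 4"
    using abs_m t Henstock_Kurzweil_Integration.integral_combine[of a t b "\<lambda>s. \<bar>s - m\<bar>"]
    by (auto simp: integral_unique integrable_on_def)
  then have "?c * integral {a..t} (\<lambda>s. \<bar>s - m\<bar>) + ?c * integral {t..b} (\<lambda>s. \<bar>s - m\<bar>) = ?c * ((b - a)\<^sup>2 / 4)"
    by (simp only: distrib_left[symmetric])
  moreover have "\<bar>P t\<bar> \<le> ?c * integral {a..t} (\<lambda>s. \<bar>s - m\<bar>)" "\<bar>P t\<bar> \<le> ?c * integral {t..b} (\<lambda>s. \<bar>s - m\<bar>)"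
    using part[of a t] part[of t b] t weights_start weights_end by auto
  ultimately show ?thesis by linarith
qed

section \<open>The corrected difference of the trajectories\<close>

text \<open>
  The derivative of \<open>Df f\<close> in direction \<open>u\<close>, and likewise for the other products of a derivative and a field.
\<close>

definition Dff :: "real ^ 'n \<Rightarrow> real ^ 'n \<Rightarrow> real ^ 'n" where "Dff z u = f' z (f' z u) + f'' z u (f z)"
definition Dfg :: "real ^ 'n \<Rightarrow> real ^ 'n \<Rightarrow> real ^ 'n" where "Dfg z u = f' z (g' z u) + f'' z u (g z)"
definition Dgf :: "real ^ 'n \<Rightarrow> real ^ 'n \<Rightarrow> real ^ 'n" where "Dgf z u = g' z (f' z u) + g'' z u (f z)"
definition Dgg :: "real ^ 'n \<Rightarrow> real ^ 'n \<Rightarrow> real ^ 'n" where "Dgg z u = g' z (g' z u) + g'' z u (g z)"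

lemma field_products_has_derivative:
  "((\<lambda>z. blinfun_apply (f' z) (f z)) has_derivative Dff z) (at z)"
  "((\<lambda>z. blinfun_apply (f' z) (g z)) has_derivative Dfg z) (at z)"
  "((\<lambda>z. blinfun_apply (g' z) (f z)) has_derivative Dgf z) (at z)"
  "((\<lambda>z. blinfun_apply (g' z) (g z)) has_derivative Dgg z) (at z)"
  unfolding Dff_def Dfg_def Dgf_def Dgg_def
  using apply_has_derivative[of f' f'' z f f'] apply_has_derivative[of f' f'' z g g']
    apply_has_derivative[of g' g'' z f f'] apply_has_derivative[of g' g'' z g g'] f' g' f'' g''
  by blast+

lemma field_products_derivative_le:
  assumes z: "z \<in> B"
  shows "infnorm (Dff z u) \<le> (L * L + H * K) * infnorm u"
    "infnorm (Dfg z u) \<le> (L * L1 + H * K1) * infnorm u"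
    "infnorm (Dgf z u) \<le> (L1 * L + H1 * K) * infnorm u"
    "infnorm (Dgg z u) \<le> (L1 * L1 + H1 * K1) * infnorm u"
  unfolding Dff_def Dfg_def Dgf_def Dgg_def
  by (intro infnorm_apply_derivative_le f'_le g'_le f''_le g''_le f_le g_le z constants_nonneg)+

lemma field_products_derivative_continuous:
  "continuous_on UNIV (\<lambda>p. Dfg (fst p) (snd p))"
  "continuous_on UNIV (\<lambda>p. Dgf (fst p) (snd p))"
  "continuous_on UNIV (\<lambda>p. Dgg (fst p) (snd p))"
  unfolding Dfg_def Dgf_def Dgg_def
  by (intro continuous_intros continuous_on_compose2[OF continuous_fields(1)]
      continuous_on_compose2[OF continuous_fields(2)] continuous_on_compose2[OF continuous_fields(3)]
      continuous_on_compose2[OF continuous_fields(4)] continuous_on_compose2[OF cont_f'']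
      continuous_on_compose2[OF cont_g''] subset_UNIV)+

lemma fields_continuous:
  "continuous_on UNIV (\<lambda>p. blinfun_apply (f' (fst p)) (snd p))"
  "continuous_on UNIV (\<lambda>p. blinfun_apply (g' (fst p)) (snd p))"
  by (intro continuous_intros continuous_on_compose2[OF continuous_fields(3)]
      continuous_on_compose2[OF continuous_fields(4)] subset_UNIV)+

lemmas along_x = primitive_on_along_solution[OF solution_x bm_v continuous_fields(1,2) _ _ convex_B x_in_B]
lemmas along_y = primitive_on_along_solution[OF solution_y bm_w continuous_fields(1,2) _ _ convex_B y_in_B]

text \<open>
  The difference of the trajectories with all boundary terms of the integrations by parts taken
  off, so that its density has no contribution of first order.
\<close>

definition M :: "real \<Rightarrow> real ^ 'n" where
  "M t = x t - y t - (t - m) *\<^sub>R (f (x t) - f (y t)) - U t *\<^sub>R g (x t) - q t *\<^sub>R (g (x t) - g (y t))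
     + P t *\<^sub>R f' (x t) (g (x t)) + W t *\<^sub>R g' (x t) (f (x t)) + R t *\<^sub>R g' (x t) (g (x t))"

definition M_dot :: "real \<Rightarrow> real ^ 'n" where
  "M_dot s =
     P s *\<^sub>R Dfg (x s) (x_dot s) + W s *\<^sub>R Dgf (x s) (x_dot s) + R s *\<^sub>R Dgg (x s) (x_dot s)
     - (s - m) *\<^sub>R ((f' (x s) (f (x s)) - f' (y s) (f (y s))) + w s *\<^sub>R (f' (x s) (g (x s)) - f' (y s) (g (y s))))
     - q s *\<^sub>R ((g' (x s) (f (x s)) - g' (y s) (f (y s))) + w s *\<^sub>R (g' (x s) (g (x s)) - g' (y s) (g (y s))))"

text \<open>
  In the density given by the product and chain rules the terms with factors \<open>u\<close> and \<open>(s - m) u\<close>, and those with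
  \<open>U\<close> in front of \<open>Dg(x) f(x)\<close>, cancel in pairs; the identity \<open>U v + q u = p v - q w\<close> cancels those in front of
  \<open>Dg(x) g(x)\<close>.
\<close>

lemma primitive_M: "primitive_on a b M M_dot"
proof -
  note px = along_x[OF f' fields_continuous(1) _ f'_le] along_x[OF g' fields_continuous(2) _ g'_le]
    along_x[OF field_products_has_derivative(2) field_products_derivative_continuous(1) _ field_products_derivative_le(2)]
    along_x[OF field_products_has_derivative(3) field_products_derivative_continuous(2) _ field_products_derivative_le(3)]
    along_x[OF field_products_has_derivative(4) field_products_derivative_continuous(3) _ field_products_derivative_le(4)]
  note py = along_y[OF f' fields_continuous(1) _ f'_le] along_y[OF g' fields_continuous(2) _ g'_le]
  let ?Mdot = "\<lambda>s. (x_dot s - y_dot s)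
      - (1 *\<^sub>R (f (x s) - f (y s)) + (s - m) *\<^sub>R (f' (x s) (x_dot s) - f' (y s) (y_dot s)))
      - ((v s - w s) *\<^sub>R g (x s) + U s *\<^sub>R g' (x s) (x_dot s))
      - (w s *\<^sub>R (g (x s) - g (y s)) + q s *\<^sub>R (g' (x s) (x_dot s) - g' (y s) (y_dot s)))
      + (((s - m) * (v s - w s)) *\<^sub>R f' (x s) (g (x s)) + P s *\<^sub>R Dfg (x s) (x_dot s))
      + (U s *\<^sub>R g' (x s) (f (x s)) + W s *\<^sub>R Dgf (x s) (x_dot s))
      + ((p s * v s - q s * w s) *\<^sub>R g' (x s) (g (x s)) + R s *\<^sub>R Dgg (x s) (x_dot s))"
  have "primitive_on a b M ?Mdot"
    unfolding M_def[abs_def]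
    by (intro primitive_on_add primitive_on_diff primitive_on_scaleR primitive_on_shift
        primitive_x primitive_y primitive_q primitive_U primitive_P primitive_W primitive_R px py)
  moreover have "?Mdot s = M_dot s" for s
    unfolding M_dot_def U_def
    by (simp add: blinfun.add_right blinfun.scaleR_right algebra_simps)
  ultimately show ?thesis by simp
qed

section \<open>The local error\<close>

lemma M_dot_le:
  assumes s: "s \<in> {a..b}"
    and gap: "infnorm (x s - y s) \<le> Z"
  shows "infnorm (M_dot s) \<le>
      (1 + r) * V1 * (b - a)\<^sup>2 / 8 * ((L * L1 + H * K1) * (K + V1 * K1))
    + (1 + r) * V1 * (s - a)\<^sup>2 / 2 * ((L1 * L + H1 * K) * (K + V1 * K1))
    + (1 + r\<^sup>2) * V1\<^sup>2 * (s - a)\<^sup>2 / 2 * ((L1 * L1 + H1 * K1) * (K + V1 * K1))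
    + \<bar>s - m\<bar> * ((L * L + H * K) * Z + r * V1 * ((L * L1 + H * K1) * Z))
    + r * V1 * (s - a) * ((L1 * L + H1 * K) * Z + r * V1 * ((L1 * L1 + H1 * K1) * Z))"
proof -
  note xB = x_in_B[OF s] and yB = y_in_B[OF s]
  have along: "infnorm (D (x_dot s)) \<le> c * (K + V1 * K1)"
    if "\<And>u. infnorm (D u) \<le> c * infnorm u" "0 \<le> c" for D :: "real ^ 'n \<Rightarrow> real ^ 'n" and c
    using that(1) mult_left_mono[OF x_dot_le[OF s] that(2)] by (rule order_trans)
  have across: "infnorm (\<Phi> (x s) - \<Phi> (y s)) \<le> c * Z"
    if "\<And>z. (\<Phi> has_derivative D z) (at z)" "\<And>z u. z \<in> B \<Longrightarrow> infnorm (D z u) \<le> c * infnorm u" "0 \<le> c"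
    for \<Phi> :: "real ^ 'n \<Rightarrow> real ^ 'n" and D c
    using infnorm_diff_le_of_derivative[OF convex_B xB yB that(1,2)] mult_left_mono[OF gap that(3)]
    by (rule order_trans)
  have nonneg: "0 \<le> L * L + H * K" "0 \<le> L * L1 + H * K1" "0 \<le> L1 * L + H1 * K" "0 \<le> L1 * L1 + H1 * K1"
    by (simp_all add: constants_nonneg)
  note across' = across[OF field_products_has_derivative(1) field_products_derivative_le(1) nonneg(1)]
    across[OF field_products_has_derivative(2) field_products_derivative_le(2) nonneg(2)]
    across[OF field_products_has_derivative(3) field_products_derivative_le(3) nonneg(3)]
    across[OF field_products_has_derivative(4) field_products_derivative_le(4) nonneg(4)]
  show ?thesis
    unfolding M_dot_def
    by (intro infnorm_diff_le infnorm_add_le infnorm_scaleR_le along across' P_le W_le R_le q_le w_le s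
        field_products_derivative_le nonneg xB order_refl)
qed

text \<open>
  Integrating the bound of \<open>M_dot_le\<close> over the step gives a value \<open>J\<close> slightly below the stated
  right-hand side: for \<open>R\<close> the estimate is twice as good. The values of \<open>M\<close> at the ends turn this
  into an inequality for \<open>x b - y b\<close>.
\<close>

lemma local_error:
  defines "h \<equiv> b - a"
  shows "(1 - L * (h / 2) - h * r * (V1 * L1)) * infnorm (x b - y b)
    \<le> h ^ 3 / 4 * (1 + r) * (V1 * K1) *
        ((2 * r * (V1 * H1) + H) * (K + r * (V1 * K1)) + L\<^sup>2 + (3 * r * L + 2 * r\<^sup>2 * (V1 * L1)) * (V1 * L1))
        * phi (\<Lambda> * h)
      + h ^ 3 / 24 * (K + V1 * K1) *
        ((1 + r) * (3 * (H * (V1 * K1) + L * (V1 * L1)) + 4 * ((V1 * H1) * K + L * (V1 * L1)))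
         + 8 * (1 + r\<^sup>2) * ((V1 * H1) * (V1 * K1) + (V1 * L1)\<^sup>2))"
    (is "?lhs \<le> ?rhs")
proof -
  define \<phi> where "\<phi> = phi (\<Lambda> * h)"
  define Z where "Z = (1 + r) * (V1 * K1) * (h * \<phi>)"
  define N where "N = infnorm (x b - y b)"
  define c1 where "c1 = (L * L + H * K) * Z + r * V1 * ((L * L1 + H * K1) * Z)"
  define c2 where "c2 = (L1 * L + H1 * K) * Z + r * V1 * ((L1 * L1 + H1 * K1) * Z)"
  define c3 where "c3 = (1 + r) * V1 * h\<^sup>2 / 8 * ((L * L1 + H * K1) * (K + V1 * K1))"
  define c4 where "c4 = (1 + r) * V1 / 2 * ((L1 * L + H1 * K) * (K + V1 * K1))
    + (1 + r\<^sup>2) * V1\<^sup>2 / 2 * ((L1 * L1 + H1 * K1) * (K + V1 * K1))"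
  define J where "J = c3 * h + c4 * (h ^ 3 / 3) + c1 * (h\<^sup>2 / 4) + r * V1 * c2 * (h\<^sup>2 / 2)"
  have h: "0 \<le> h" using less by (simp add: h_def)
  have mid: "b - m = h / 2" by (simp add: m_def h_def field_simps)
  have "infnorm (M b - M a) \<le> J"
  proof (rule infnorm_primitive_le[OF primitive_M])
    fix s assume s: "s \<in> {a..b}"
    have "infnorm (x s - y s) \<le> Z"
      using trajectories_diff_le[OF s] by (simp add: Z_def \<phi>_def h_def)
    note M_dot_le[OF s this]
    also have "(1 + r) * V1 * (b - a)\<^sup>2 / 8 * ((L * L1 + H * K1) * (K + V1 * K1))
        + (1 + r) * V1 * (s - a)\<^sup>2 / 2 * ((L1 * L + H1 * K) * (K + V1 * K1))
        + (1 + r\<^sup>2) * V1\<^sup>2 * (s - a)\<^sup>2 / 2 * ((L1 * L1 + H1 * K1) * (K + V1 * K1))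
        + \<bar>s - m\<bar> * ((L * L + H * K) * Z + r * V1 * ((L * L1 + H * K1) * Z))
        + r * V1 * (s - a) * ((L1 * L + H1 * K) * Z + r * V1 * ((L1 * L1 + H1 * K1) * Z))
      = c3 + c4 * (s - a) ^ 2 + c1 * \<bar>s - m\<bar> + r * V1 * c2 * (s - a) ^ 1"
      unfolding c1_def[symmetric] c2_def[symmetric] c3_def h_def c4_def
      by (simp add: field_simps)
    finally show "infnorm (M_dot s) \<le> c3 + c4 * (s - a) ^ 2 + c1 * \<bar>s - m\<bar> + r * V1 * c2 * (s - a) ^ 1" .
  next
    have "((\<lambda>_. c3) has_integral c3 * h) {a..b}"
      using has_integral_const_real[of c3 a b] less by (simp add: h_def mult.commute)
    moreover have "((\<lambda>s. c4 * (s - a) ^ 2) has_integral c4 * (h ^ 3 / 3)) {a..b}"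
      using has_integral_mult_right[OF has_integral_shift_power[of a b 2]] less
      by (simp add: h_def numeral_3_eq_3)
    moreover have "((\<lambda>s. c1 * \<bar>s - m\<bar>) has_integral c1 * (h\<^sup>2 / 4)) {a..b}"
      using has_integral_mult_right[OF has_integral_abs_midpoint[of a b]] less
      by (simp add: h_def m_def)
    moreover have "((\<lambda>s. r * V1 * c2 * (s - a) ^ 1) has_integral r * V1 * c2 * (h\<^sup>2 / 2)) {a..b}"
      using has_integral_mult_right[OF has_integral_shift_power[of a b 1]] less
      by (simp add: h_def numeral_2_eq_2)
    ultimately show "((\<lambda>s. c3 + c4 * (s - a) ^ 2 + c1 * \<bar>s - m\<bar> + r * V1 * c2 * (s - a) ^ 1) has_integral J) {a..b}"
      unfolding J_def by (intro has_integral_add)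
  qed (use less in auto)
  moreover have "M a = 0"
    by (simp add: M_def start weights_start)
  moreover have "M b = (x b - y b) - (h / 2) *\<^sub>R (f (x b) - f (y b)) - q b *\<^sub>R (g (x b) - g (y b))"
    using mid by (simp add: M_def weights_end)
  ultimately have MJ: "infnorm ((x b - y b) - (h / 2) *\<^sub>R (f (x b) - f (y b)) - q b *\<^sub>R (g (x b) - g (y b))) \<le> J"
    by simp
  have bB: "x b \<in> B" "y b \<in> B" using x_in_B y_in_B less by auto
  have "infnorm ((h / 2) *\<^sub>R (f (x b) - f (y b))) \<le> (h / 2) * (L * N)"
    unfolding N_def using h bB by (intro infnorm_scaleR_le f_Lipschitz) auto
  moreover have "infnorm (q b *\<^sub>R (g (x b) - g (y b))) \<le> (r * V1 * h) * (L1 * N)"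
    unfolding N_def using q_le[of b] less bB by (intro infnorm_scaleR_le g_Lipschitz) (auto simp: h_def)
  ultimately have "infnorm (((x b - y b) - (h / 2) *\<^sub>R (f (x b) - f (y b)) - q b *\<^sub>R (g (x b) - g (y b)))
      + (h / 2) *\<^sub>R (f (x b) - f (y b)) + q b *\<^sub>R (g (x b) - g (y b)))
      \<le> J + (h / 2) * (L * N) + (r * V1 * h) * (L1 * N)"
    by (intro infnorm_add_le MJ)
  then have "N \<le> J + (h / 2) * (L * N) + (r * V1 * h) * (L1 * N)"
    by (simp add: N_def)
  then have "?lhs \<le> J"
    unfolding N_def[symmetric] by (simp add: algebra_simps)
  also have "J \<le> ?rhs"
  proof -
    \<comment> \<open>All terms cancel except half of the one with factor \<open>8 (1 + r\<^sup>2)\<close>.\<close>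
    have "?rhs - J = h ^ 3 * (K + V1 * K1) * ((1 + r\<^sup>2) * (V1\<^sup>2 * (H1 * K1 + L1 * L1))) / 6"
      unfolding \<phi>_def[symmetric] J_def c1_def c2_def c3_def c4_def Z_def
      by (simp add: field_simps power2_eq_square power3_eq_cube)
    also have "0 \<le> \<dots>"
      using constants_nonneg V1 h by simp
    finally show ?thesis by simp
  qed
  finally show ?thesis .
qed

end

theorem corollary2:
  fixes T V1 K K1 \<Lambda> L L1 H H1 K' L' H' r :: real
  assumes "0 < T" and "0 < V1"
    and "K' = V1 * K1" and "L' = V1 * L1" and "H' = V1 * H1"
  shows "\<exists>C \<delta>. 0 < \<delta> \<and>
    (\<forall>(f :: real ^ 'n \<Rightarrow> real ^ 'n) (g :: real ^ 'n \<Rightarrow> real ^ 'n) (B :: (real ^ 'n) set)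
      N t k v w x y h tmid.
      C2 f \<and> C2 g \<and>
      (\<exists>lo hi. B = cbox lo hi) \<and>
      (\<forall>z\<in>B. infnorm (f z) \<le> K \<and> infnorm (g z) \<le> K1 \<and>
              log_infnorm (jacobian f (at z)) \<le> \<Lambda> \<and>
              matrix_infnorm (jacobian f (at z)) \<le> L \<and>
              matrix_infnorm (jacobian g (at z)) \<le> L1 \<and>
              bilinear_infnorm (second_derivative f z) \<le> H \<and>
              bilinear_infnorm (second_derivative g z) \<le> H1) \<and>
      time_partition T N t \<and> k < N \<and> h = t (Suc k) - t k \<and> tmid = t k + h / 2 \<and>
      input V1 0 T v \<and>
      input (r * V1) (t k) (t (Suc k)) w \<and>
      integral\<^sup>L (lebesgue_on {t k..t (Suc k)}) (\<lambda>s. v s - w s) = 0 \<and>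
      integral\<^sup>L (lebesgue_on {t k..t (Suc k)}) (\<lambda>s. (s - tmid) * (v s - w s)) = 0 \<and>
      solution f g v (t k) (t (Suc k)) x \<and>
      solution f g w (t k) (t (Suc k)) y \<and>
      x (t k) = y (t k) \<and>
      (\<forall>s\<in>{t k..t (Suc k)}. x s \<in> B \<and> y s \<in> B)
      \<longrightarrow>
      (h < \<delta> \<longrightarrow> infnorm (x (t (Suc k)) - y (t (Suc k))) \<le> C * h ^ 3) \<and>
      (1 - L * (h / 2) - h * r * L') * infnorm (x (t (Suc k)) - y (t (Suc k)))
        \<le> h ^ 3 / 4 * (1 + r) * K' *
            ((2 * r * H' + H) * (K + r * K') + L\<^sup>2 + (3 * r * L + 2 * r\<^sup>2 * L') * L') * phi (\<Lambda> * h)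
          + h ^ 3 / 24 * (K + K') *
            ((1 + r) * (3 * (H * K' + L * L') + 4 * (H' * K + L * L'))
             + 8 * (1 + r\<^sup>2) * (H' * K' + L'\<^sup>2)))"
proof -
  \<comment> \<open>For \<open>h < \<delta>\<close> the factor \<open>1 - L h/2 - h r L'\<close> is at least \<open>1/2\<close>, whence the factor \<open>2\<close> in the
    constant; \<open>A\<close> and \<open>D\<close> are the coefficients of \<open>h\<^sup>3\<close>.\<close>
  define \<delta> where "\<delta> = 1 / (\<bar>L\<bar> + 2 * \<bar>r * L'\<bar> + 1)"
  define A where "A = (1 + r) * K' / 4 *
    ((2 * r * H' + H) * (K + r * K') + L\<^sup>2 + (3 * r * L + 2 * r\<^sup>2 * L') * L')"
  define D where "D = (K + K') / 24 *
    ((1 + r) * (3 * (H * K' + L * L') + 4 * (H' * K + L * L')) + 8 * (1 + r\<^sup>2) * (H' * K' + L'\<^sup>2))"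
  have \<delta>: "0 < \<delta>" by (simp add: \<delta>_def add_nonneg_pos)
  show ?thesis
  proof (rule exI[of _ "2 * (A * exp (\<bar>\<Lambda>\<bar> * \<delta>) + D)"], rule exI[of _ \<delta>], intro conjI[OF \<delta>] allI, rule impI,
      elim conjE exE)
    fix f g :: "real ^ 'n \<Rightarrow> real ^ 'n" and B :: "(real ^ 'n) set" and N :: nat
      and t :: "nat \<Rightarrow> real" and k :: nat and v w :: "real \<Rightarrow> real" and x y :: "real \<Rightarrow> real ^ 'n"
      and h tmid :: real and lo hi
    assume fg: "C2 f" "C2 g" and B: "B = cbox lo hi"
      and bounds: "\<forall>z\<in>B. infnorm (f z) \<le> K \<and> infnorm (g z) \<le> K1 \<and>
              log_infnorm (jacobian f (at z)) \<le> \<Lambda> \<and>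
              matrix_infnorm (jacobian f (at z)) \<le> L \<and>
              matrix_infnorm (jacobian g (at z)) \<le> L1 \<and>
              bilinear_infnorm (second_derivative f z) \<le> H \<and>
              bilinear_infnorm (second_derivative g z) \<le> H1"
      and part: "time_partition T N t" "k < N" and h: "h = t (Suc k) - t k" "tmid = t k + h / 2"
      and v: "input V1 0 T v" and w: "input (r * V1) (t k) (t (Suc k)) w"
      and m0: "integral\<^sup>L (lebesgue_on {t k..t (Suc k)}) (\<lambda>s. v s - w s) = 0"
      and m1: "integral\<^sup>L (lebesgue_on {t k..t (Suc k)}) (\<lambda>s. (s - tmid) * (v s - w s)) = 0"
      and sol: "solution f g v (t k) (t (Suc k)) x" "solution f g w (t k) (t (Suc k)) y"
      and start: "x (t k) = y (t k)"
      and in_B: "\<forall>s\<in>{t k..t (Suc k)}. x s \<in> B \<and> y s \<in> B"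
    have step: "t i < t (Suc i)" if "i < N" for i
      using part(1) that by (simp add: time_partition_def)
    have up: "t 0 \<le> t i" if "i \<le> N" for i
      using that
    proof (induction i)
      case (Suc i)
      then show ?case using step[of i] by simp
    qed simp
    have down: "t (N - i) \<le> t N" if "i \<le> N" for i
      using that
    proof (induction i)
      case (Suc i)
      then have "t (N - Suc i) < t (Suc (N - Suc i))" by (intro step) auto
      with Suc show ?case by (simp add: Suc_diff_Suc)
    qed simp
    have "{t k..t (Suc k)} \<subseteq> {0..T}"
      using up[of k] down[of "N - Suc k"] part by (auto simp: time_partition_def)
    then have v': "input V1 (t k) (t (Suc k)) v"
      using v unfolding input_def by (auto intro: measurable_restrict_mono)
    have diff: "bounded_measurable_on (t k) (t (Suc k)) (\<lambda>s. v s - w s)"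
      by (intro bounded_measurable_on_diff bounded_measurable_on_input[OF v'] bounded_measurable_on_input[OF w])
    have "bounded_measurable_on (t k) (t (Suc k)) (\<lambda>s. (s - tmid) *\<^sub>R (v s - w s))"
      by (intro bounded_measurable_on_scaleR diff bounded_measurable_on_continuous continuous_intros)
    then have moment1: "integral {t k..t (Suc k)} (\<lambda>s. (s - tmid) * (v s - w s)) = 0"
      using lebesgue_integral_eq_integral[OF bounded_measurable_on_integrable] m1 by fastforce
    have moment0: "integral {t k..t (Suc k)} (\<lambda>s. v s - w s) = 0"
      using lebesgue_integral_eq_integral[OF bounded_measurable_on_integrable[OF diff]] m0 by simp
    obtain f' f'' where f: "\<And>z. (f has_derivative blinfun_apply (f' z)) (at z)"
      "\<And>z. (f' has_derivative blinfun_apply (f'' z)) (at z)" "continuous_on UNIV f''"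
      "\<And>z u. blinfun_apply (f' z) u = jacobian f (at z) *v u"
      "\<And>z c u. matrix_infnorm (jacobian f (at z)) \<le> c \<Longrightarrow> infnorm (f' z u) \<le> c * infnorm u"
      "\<And>z c u1 u2. bilinear_infnorm (second_derivative f z) \<le> c
           \<Longrightarrow> infnorm (f'' z u1 u2) \<le> c * (infnorm u1 * infnorm u2)"
      by (rule C2_infnorm_bounds[OF fg(1)]) blast
    obtain g' g'' where g: "\<And>z. (g has_derivative blinfun_apply (g' z)) (at z)"
      "\<And>z. (g' has_derivative blinfun_apply (g'' z)) (at z)" "continuous_on UNIV g''"
      "\<And>z u. blinfun_apply (g' z) u = jacobian g (at z) *v u"
      "\<And>z c u. matrix_infnorm (jacobian g (at z)) \<le> c \<Longrightarrow> infnorm (g' z u) \<le> c * infnorm u"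
      "\<And>z c u1 u2. bilinear_infnorm (second_derivative g z) \<le> c
           \<Longrightarrow> infnorm (g'' z u1 u2) \<le> c * (infnorm u1 * infnorm u2)"
      by (rule C2_infnorm_bounds[OF fg(2)]) blast
    interpret two_inputs f g f' g' f'' g'' B K K1 L L1 H H1 \<Lambda> V1 r "t k" "t (Suc k)" v w x y
    proof
      show "infnorm (u + d *\<^sub>R blinfun_apply (f' z) u) \<le> (1 + d * \<Lambda>) * infnorm u"
        if "z \<in> B" "0 \<le> d" "d * L \<le> 1" for z u d
        unfolding f(4) using bounds that by (intro infnorm_Euler_matrix_le) auto
      show "integral {t k..t (Suc k)} (\<lambda>s. (s - (t k + (t (Suc k) - t k) / 2)) * (v s - w s)) = 0"
        using moment1 by (simp add: h)
    qed (use bounds f g B \<open>0 < V1\<close> step[OF part(2)] v' w moment0 sol start in_B convex_box in auto)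
    have bound: "(1 - L * (h / 2) - h * r * L') * infnorm (x (t (Suc k)) - y (t (Suc k)))
        \<le> h ^ 3 / 4 * (1 + r) * K' *
            ((2 * r * H' + H) * (K + r * K') + L\<^sup>2 + (3 * r * L + 2 * r\<^sup>2 * L') * L') * phi (\<Lambda> * h)
          + h ^ 3 / 24 * (K + K') *
            ((1 + r) * (3 * (H * K' + L * L') + 4 * (H' * K + L * L'))
             + 8 * (1 + r\<^sup>2) * (H' * K' + L'\<^sup>2))"
      using local_error by (simp only: h(1) assms(3-5))
    have "infnorm (x (t (Suc k)) - y (t (Suc k))) \<le> 2 * (A * exp (\<bar>\<Lambda>\<bar> * \<delta>) + D) * h ^ 3" if "h < \<delta>"
    proof -
      have factor: "h ^ 3 / 4 * (1 + r) * K' * E * c + h ^ 3 / 24 * (K + K') * G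
          = h ^ 3 * ((1 + r) * K' / 4 * E * c + (K + K') / 24 * G)" for E G c
        by (simp add: field_simps)
      let ?e = "infnorm (x (t (Suc k)) - y (t (Suc k)))"
      have h0: "0 < h" using step[OF part(2)] by (simp add: h)
      have half: "1 / 2 \<le> 1 - L * (h / 2) - h * r * L'"
        if "h * (l + 2 * c + 1) \<le> 1" "L \<le> l" "r * L' \<le> c" for l c
      proof -
        have "h * L \<le> h * l" "h * (r * L') \<le> h * c"
          using that h0 by (intro mult_left_mono; simp)+
        moreover have "h * (l + 2 * c + 1) = h * l + 2 * (h * c) + h"
          "L * (h / 2) = (h * L) / 2" "h * r * L' = h * (r * L')"
          by (simp_all add: algebra_simps)
        ultimately show ?thesis
          using that(1) h0 by linarith
      qed
      have "h * (\<bar>L\<bar> + 2 * \<bar>r * L'\<bar> + 1) \<le> 1"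
        using that unfolding \<delta>_def by (simp add: less_divide_eq add_nonneg_pos)
      from half[OF this abs_ge_self abs_ge_self]
      have "1 / 2 * ?e \<le> (1 - L * (h / 2) - h * r * L') * ?e"
        by (intro mult_right_mono infnorm_pos_le)
      also note bound
      also have "h ^ 3 / 4 * (1 + r) * K' *
            ((2 * r * H' + H) * (K + r * K') + L\<^sup>2 + (3 * r * L + 2 * r\<^sup>2 * L') * L') * phi (\<Lambda> * h)
          + h ^ 3 / 24 * (K + K') *
            ((1 + r) * (3 * (H * K' + L * L') + 4 * (H' * K + L * L'))
             + 8 * (1 + r\<^sup>2) * (H' * K' + L'\<^sup>2)) = h ^ 3 * (A * phi (\<Lambda> * h) + D)"
        unfolding A_def D_def by (rule factor)
      also have "\<dots> \<le> h ^ 3 * (A * exp (\<bar>\<Lambda>\<bar> * \<delta>) + D)"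
      proof -
        have "phi (\<Lambda> * h) \<le> exp \<bar>\<Lambda> * h\<bar>" by (rule phi_le_exp)
        also have "\<dots> \<le> exp (\<bar>\<Lambda>\<bar> * \<delta>)"
          using that h0 by (auto simp: abs_mult intro!: mult_left_mono)
        finally have "phi (\<Lambda> * h) \<le> exp (\<bar>\<Lambda>\<bar> * \<delta>)" .
        moreover have "0 \<le> A"
          unfolding A_def assms(3-5) using constants_nonneg \<open>0 < V1\<close> by simp
        ultimately show ?thesis
          using h0 by (intro mult_left_mono add_right_mono) auto
      qed
      finally show ?thesis by (simp add: algebra_simps)
    qed
    with bound show "(h < \<delta> \<longrightarrow> infnorm (x (t (Suc k)) - y (t (Suc k))) \<le> 2 * (A * exp (\<bar>\<Lambda>\<bar> * \<delta>) + D) * h ^ 3) \<and>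
      (1 - L * (h / 2) - h * r * L') * infnorm (x (t (Suc k)) - y (t (Suc k)))
        \<le> h ^ 3 / 4 * (1 + r) * K' *
            ((2 * r * H' + H) * (K + r * K') + L\<^sup>2 + (3 * r * L + 2 * r\<^sup>2 * L') * L') * phi (\<Lambda> * h)
          + h ^ 3 / 24 * (K + K') *
            ((1 + r) * (3 * (H * K' + L * L') + 4 * (H' * K + L * L'))
             + 8 * (1 + r\<^sup>2) * (H' * K' + L'\<^sup>2))"
      by blast
  qed
qed

end
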